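(* Let $(X,d)$ be a flexible space and let $A$ be a $\mathrm{C}^*$-algebra. Suppose that $\mathfrak d=\omega_1$ and $2^{\aleph_0}<2^{\aleph_1}$. Then the $\mathrm{C}^*$-algebra $Q(X,A)=C_b(X,A)/C_0(X,A)$ has $2^{\aleph_1}$ many automorphisms. In particular, under $\mathrm{CH}$, $Q(X,A)$ has $2^{\mathfrak c}$ many automorphisms.
   Context: $C_b(X,A)$ is the $\mathrm{C}^*$-algebra of bounded continuous functions $X\to A$ (pointwise operations, sup norm), and $C_0(X,A)$ its ideal of functions vanishing at infinity. $\mathfrak d$ is the least cardinality of a family $F\subseteq\mathbb N^{\mathbb N}$ cofinal in the order $f\le^* g\iff g(n)\ge f(n)$ for all but finitely many $n$; $\mathfrak c=2^{\aleph_0}$. For a closed $Y\subseteq X$, $\mathrm{Homeo}_{\mathrm{bd}}(Y)$ is the set of homeomorphisms $\phi$ of $Y$ such that $\phi(y)=y$ for all $y\in Y\cap\overline{X\setminus Y}$. For a homeomorphism $\phi$ (of $X$ or of a subset), its radius is $r(\phi)=\sup_x d(x,\phi(x))$. A locally compact noncompact Polish space $(X,d)$ ($d$ a metric inducing the topology) is flexible if there are pairwise disjoint sets $Y_n\subseteq X$ ($n\in\mathbb N$) and $\phi_{n,m}\in\mathrm{Homeo}_{\mathrm{bd}}(Y_n)$ ($n,m\in\mathbb N$) such that: (1) every $Y_n$ is compact and no compact subset of $X$ intersects infinitely many $Y_n$; (2) for every $n$, $(r(\phi_{n,m}))_m$ is a decreasing sequence tending to $0$ as $m\to\infty$, with $r(\phi_{n,m})\neq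 0$ for all $n,m$.
   Formalization: The algebra A is assumed nonzero (for A=0 there is only one automorphism), and "has 2^{ℵ1} (resp. 2^c) many automorphisms" is stated as "at least that many", since for very large A, such as B(H) with H of huge dimension, there are more. *)

theory Defs
  imports "HOL-Analysis.Analysis"
begin

unbundle cardinal_syntax
no_notation elt_set_eq (infix \<open>=o\<close> 50)

section \<open>C*-algebras\<close>

text \<open>Not necessarily unital. The real algebra structure underlying the normed-algebra classes is
  the restriction of the complex one.\<close>

class cstar_algebra = real_normed_algebra + banach +
  fixes scaleC :: "complex \<Rightarrow> 'a \<Rightarrow> 'a" (infixr \<open>*\<^sub>C\<close> 75)
    and star :: "'a \<Rightarrow> 'a"
  assumes scaleC_add_right: "c *\<^sub>C (x + y) = c *\<^sub>C x + c *\<^sub>C y"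
    and scaleC_add_left: "(c + d) *\<^sub>C x = c *\<^sub>C x + d *\<^sub>C x"
    and scaleC_scaleC: "c *\<^sub>C d *\<^sub>C x = (c * d) *\<^sub>C x"
    and scaleR_scaleC: "r *\<^sub>R x = complex_of_real r *\<^sub>C x"
    and mult_scaleC_left: "(c *\<^sub>C x) * y = c *\<^sub>C (x * y)"
    and mult_scaleC_right: "x * (c *\<^sub>C y) = c *\<^sub>C (x * y)"
    and norm_scaleC: "norm (c *\<^sub>C x) = cmod c * norm x"
    and star_star: "star (star x) = x"
    and star_add: "star (x + y) = star x + star y"
    and star_mult: "star (x * y) = star y * star x"
    and star_scaleC: "star (c *\<^sub>C x) = cnj c *\<^sub>C star x"
    and cstar_identity: "norm (star x * x) = (norm x)\<^sup>2"
begin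

definition star_automorphism :: "('a \<Rightarrow> 'a) \<Rightarrow> bool" where
  "star_automorphism \<Phi> \<longleftrightarrow> bij \<Phi> \<and>
    (\<forall>x y. \<Phi> (x + y) = \<Phi> x + \<Phi> y) \<and>
    (\<forall>c x. \<Phi> (c *\<^sub>C x) = c *\<^sub>C \<Phi> x) \<and>
    (\<forall>x y. \<Phi> (x * y) = \<Phi> x * \<Phi> y) \<and>
    (\<forall>x. \<Phi> (star x) = star (\<Phi> x))"

end

lemma norm_star_le: "norm x \<le> norm (star x)" for x :: "'a::cstar_algebra"
proof (cases "x = 0")
  case False
  have "norm x * norm x \<le> norm (star x) * norm x"
    using norm_mult_ineq[of "star x" x] cstar_identity[of x] by (simp add: power2_eq_square)
  then show ?thesis using False by simp
qed simp

lemma norm_star [simp]: "norm (star x) = norm x" for x :: "'a::cstar_algebra"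
  using norm_star_le[of x] norm_star_le[of "star x"] by (simp add: star_star)

lemma star_diff: "star (x - y) = star x - star y" for x y :: "'a::cstar_algebra"
  by (metis add_diff_cancel diff_add_cancel star_add)

lemma scaleC_diff_right: "c *\<^sub>C (x - y) = c *\<^sub>C x - c *\<^sub>C y" for x y :: "'a::cstar_algebra"
  by (metis add_diff_cancel diff_add_cancel scaleC_add_right)

lemma scaleC_one [simp]: "1 *\<^sub>C x = x" for x :: "'a::cstar_algebra"
  by (metis scaleR_scaleC scaleR_one of_real_1)

lemma bounded_linear_star: "bounded_linear (star :: 'a \<Rightarrow> 'a::cstar_algebra)"
  by (rule bounded_linear_intro[of _ 1]) (simp_all add: star_add scaleR_scaleC star_scaleC)

lemma bounded_linear_scaleC: "bounded_linear ((*\<^sub>C) c :: 'a \<Rightarrow> 'a::cstar_algebra)"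
  by (rule bounded_linear_intro[of _ "cmod c"])
    (simp_all add: scaleC_add_right scaleR_scaleC norm_scaleC scaleC_scaleC mult.commute)


section \<open>The algebra of bounded continuous functions\<close>

unbundle bcontfun.lifting

instantiation bcontfun :: (metric_space, cstar_algebra) cstar_algebra
begin

lift_definition times_bcontfun :: "('a \<Rightarrow>\<^sub>C 'b) \<Rightarrow> ('a \<Rightarrow>\<^sub>C 'b) \<Rightarrow> 'a \<Rightarrow>\<^sub>C 'b"
  is "\<lambda>f g x. f x * g x"
proof -
  fix f g :: "'a \<Rightarrow> 'b" assume fg: "f \<in> bcontfun" "g \<in> bcontfun"
  then obtain b c where b: "\<And>x. norm (f x) \<le> b" and c: "\<And>x. norm (g x) \<le> c"
    unfolding bcontfun_def bounded_iff by auto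
  have "norm (f x * g x) \<le> b * c" for x
    using norm_mult_ineq[of "f x" "g x"] mult_mono[OF b[of x] c[of x]] b[of x] norm_ge_zero[of "f x"]
    by (smt (verit) norm_ge_zero)
  then show "(\<lambda>x. f x * g x) \<in> bcontfun"
    using fg by (intro bcontfun_normI[of _ "b * c"]) (auto simp: bcontfun_def intro!: continuous_intros)
qed

lift_definition scaleC_bcontfun :: "complex \<Rightarrow> ('a \<Rightarrow>\<^sub>C 'b) \<Rightarrow> 'a \<Rightarrow>\<^sub>C 'b"
  is "\<lambda>c f x. c *\<^sub>C f x"
proof -
  fix c and f :: "'a \<Rightarrow> 'b" assume f: "f \<in> bcontfun"
  then obtain b where b: "\<And>x. norm (f x) \<le> b"
    unfolding bcontfun_def bounded_iff by auto
  show "(\<lambda>x. c *\<^sub>C f x) \<in> bcontfun"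
    using f b by (intro bcontfun_normI[of _ "cmod c * b"])
      (auto simp: bcontfun_def norm_scaleC mult_left_mono
        intro!: bounded_linear.continuous_on[OF bounded_linear_scaleC])
qed

lift_definition star_bcontfun :: "('a \<Rightarrow>\<^sub>C 'b) \<Rightarrow> 'a \<Rightarrow>\<^sub>C 'b"
  is "\<lambda>f x. star (f x)"
proof -
  fix f :: "'a \<Rightarrow> 'b" assume f: "f \<in> bcontfun"
  then obtain b where b: "\<And>x. norm (f x) \<le> b"
    unfolding bcontfun_def bounded_iff by auto
  show "(\<lambda>x. star (f x)) \<in> bcontfun"
    using f b by (intro bcontfun_normI[of _ b])
      (auto simp: bcontfun_def intro!: bounded_linear.continuous_on[OF bounded_linear_star])
qed

lemmas [simp] = times_bcontfun.rep_eq scaleC_bcontfun.rep_eq star_bcontfun.rep_eq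

instance
proof
  fix f g h :: "'a \<Rightarrow>\<^sub>C 'b" and r :: real and c d :: complex
  show "f * g * h = f * (g * h)" by (rule bcontfun_eqI) (simp add: mult.assoc)
  show "(f + g) * h = f * h + g * h" by (rule bcontfun_eqI) (simp add: algebra_simps)
  show "f * (g + h) = f * g + f * h" by (rule bcontfun_eqI) (simp add: algebra_simps)
  show "r *\<^sub>R f * g = r *\<^sub>R (f * g)" by (rule bcontfun_eqI) simp
  show "f * r *\<^sub>R g = r *\<^sub>R (f * g)" by (rule bcontfun_eqI) simp
  show norm_mult: "norm (f * g) \<le> norm f * norm g" for f g :: "'a \<Rightarrow>\<^sub>C 'b"
  proof (rule norm_bound)
    fix x
    have "norm (apply_bcontfun (f * g) x) \<le> norm (f x) * norm (g x)" by (simp add: norm_mult_ineq)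
    also have "\<dots> \<le> norm f * norm g" by (intro mult_mono norm_bounded) auto
    finally show "norm (apply_bcontfun (f * g) x) \<le> norm f * norm g" .
  qed
  show "c *\<^sub>C (f + g) = c *\<^sub>C f + c *\<^sub>C g" by (rule bcontfun_eqI) (simp add: scaleC_add_right)
  show "(c + d) *\<^sub>C f = c *\<^sub>C f + d *\<^sub>C f" by (rule bcontfun_eqI) (simp add: scaleC_add_left)
  show "c *\<^sub>C d *\<^sub>C f = (c * d) *\<^sub>C f" by (rule bcontfun_eqI) (simp add: scaleC_scaleC)
  show "r *\<^sub>R f = complex_of_real r *\<^sub>C f" by (rule bcontfun_eqI) (simp add: scaleR_scaleC)
  show "(c *\<^sub>C f) * g = c *\<^sub>C (f * g)" by (rule bcontfun_eqI) (simp add: mult_scaleC_left)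
  show "f * (c *\<^sub>C g) = c *\<^sub>C (f * g)" by (rule bcontfun_eqI) (simp add: mult_scaleC_right)
  show "star (star f) = f" by (rule bcontfun_eqI) (simp add: star_star)
  show "star (f + g) = star f + star g" by (rule bcontfun_eqI) (simp add: star_add)
  show "star (f * g) = star g * star f" by (rule bcontfun_eqI) (simp add: star_mult)
  show "star (c *\<^sub>C f) = cnj c *\<^sub>C star f" by (rule bcontfun_eqI) (simp add: star_scaleC)
  have norm_le: "norm (c *\<^sub>C f) \<le> cmod c * norm f" for c and f :: "'a \<Rightarrow>\<^sub>C 'b"
    by (rule norm_bound) (simp add: norm_scaleC mult_left_mono norm_bounded)
  show "norm (c *\<^sub>C f) = cmod c * norm f"
  proof (cases "c = 0")
    case True
    then show ?thesis using norm_le[of c f] by simp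
  next
    case False
    have "inverse c *\<^sub>C c *\<^sub>C f = f"
      by (rule bcontfun_eqI) (use False in \<open>simp add: scaleC_scaleC\<close>)
    then have "norm f \<le> inverse (cmod c) * norm (c *\<^sub>C f)"
      using norm_le[of "inverse c" "c *\<^sub>C f"] by (simp add: norm_inverse)
    then show ?thesis using norm_le[of c f] False by (simp add: field_simps)
  qed
  have star_le: "norm (star f) \<le> norm f" for f :: "'a \<Rightarrow>\<^sub>C 'b"
    by (rule norm_bound) (simp add: norm_bounded)
  show "norm (star f * f) = (norm f)\<^sup>2"
  proof (rule antisym)
    show "norm (star f * f) \<le> (norm f)\<^sup>2"
      using norm_mult[of "star f" f] mult_right_mono[OF star_le[of f] norm_ge_zero[of f]]
      by (simp add: power2_eq_square)
    have "norm (f x) \<le> sqrt (norm (star f * f))" for x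
    proof (rule real_le_rsqrt)
      have "(norm (f x))\<^sup>2 = norm (apply_bcontfun (star f * f) x)" by (simp add: cstar_identity)
      also have "\<dots> \<le> norm (star f * f)" by (rule norm_bounded)
      finally show "(norm (f x))\<^sup>2 \<le> norm (star f * f)" .
    qed
    then have "norm f \<le> sqrt (norm (star f * f))" by (rule norm_bound)
    then have "(norm f)\<^sup>2 \<le> (sqrt (norm (star f * f)))\<^sup>2" by (rule power_mono) simp
    then show "(norm f)\<^sup>2 \<le> norm (star f * f)" by simp
  qed
qed

end

lifting_update bcontfun.lifting
lifting_forget bcontfun.lifting


section \<open>The corona algebra\<close>

definition vanishing_at_infinity :: "('x::metric_space \<Rightarrow>\<^sub>C 'a::real_normed_vector) set" where
  "vanishing_at_infinity = {f. \<forall>e>0. \<exists>K. compact K \<and> (\<forall>x. x \<notin> K \<longrightarrow> norm (apply_bcontfun f x) < e)}"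

lemma vanishingI:
  assumes "\<And>e. e > 0 \<Longrightarrow> \<exists>K. compact K \<and> (\<forall>x. x \<notin> K \<longrightarrow> norm (apply_bcontfun f x) < e)"
  shows "f \<in> vanishing_at_infinity"
  using assms by (auto simp: vanishing_at_infinity_def)

lemma vanishingD:
  assumes "f \<in> vanishing_at_infinity" "e > 0"
  obtains K where "compact K" "\<And>x. x \<notin> K \<Longrightarrow> norm (apply_bcontfun f x) < e"
  using assms by (auto simp: vanishing_at_infinity_def)

lemma vanishing_zero: "0 \<in> vanishing_at_infinity"
  by (rule vanishingI) (auto intro: exI[of _ "{}"])

lemma vanishing_dominated:
  assumes f: "f \<in> vanishing_at_infinity"
    and le: "\<And>x. norm (apply_bcontfun g x) \<le> k * norm (apply_bcontfun f x)"
  shows "g \<in> vanishing_at_infinity"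
proof (rule vanishingI)
  fix e :: real assume "e > 0"
  then have "e / (\<bar>k\<bar> + 1) > 0" by (simp add: add_nonneg_pos)
  then obtain K where K: "compact K" "\<And>x. x \<notin> K \<Longrightarrow> norm (f x) < e / (\<bar>k\<bar> + 1)"
    using vanishingD[OF f] by blast
  have "norm (g x) < e" if "x \<notin> K" for x
  proof -
    have "norm (g x) \<le> (\<bar>k\<bar> + 1) * norm (f x)"
      using le[of x] mult_right_mono[OF _ norm_ge_zero[of "f x"], of k "\<bar>k\<bar> + 1"] by force
    also have "\<dots> < e" using K(2)[OF that] by (simp add: field_simps add_nonneg_pos)
    finally show ?thesis .
  qed
  with K(1) show "\<exists>K. compact K \<and> (\<forall>x. x \<notin> K \<longrightarrow> norm (g x) < e)" by blast
qed

lemma vanishing_add: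
  assumes f: "f \<in> vanishing_at_infinity" and g: "g \<in> vanishing_at_infinity"
  shows "f + g \<in> vanishing_at_infinity"
proof (rule vanishingI)
  fix e :: real assume "e > 0"
  then have e2: "e / 2 > 0" by simp
  obtain K where K: "compact K" "\<And>x. x \<notin> K \<Longrightarrow> norm (f x) < e / 2"
    using vanishingD[OF f e2] by blast
  obtain L where L: "compact L" "\<And>x. x \<notin> L \<Longrightarrow> norm (g x) < e / 2"
    using vanishingD[OF g e2] by blast
  have "norm (apply_bcontfun (f + g) x) < e" if "x \<notin> K \<union> L" for x
    using K(2)[of x] L(2)[of x] that norm_triangle_ineq[of "f x" "g x"] by auto
  moreover have "compact (K \<union> L)" using K(1) L(1) by (rule compact_Un)
  ultimately show "\<exists>K. compact K \<and> (\<forall>x. x \<notin> K \<longrightarrow> norm (apply_bcontfun (f + g) x) < e)" by blast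
qed

lemma vanishing_uminus: "f \<in> vanishing_at_infinity \<Longrightarrow> - f \<in> vanishing_at_infinity"
  by (rule vanishing_dominated[of f _ 1]) auto

lemma vanishing_mult_left:
  fixes f g :: "'x::metric_space \<Rightarrow>\<^sub>C 'a::cstar_algebra"
  assumes "f \<in> vanishing_at_infinity" shows "g * f \<in> vanishing_at_infinity"
proof (rule vanishing_dominated[OF assms, of _ "norm g"])
  fix x
  show "norm (apply_bcontfun (g * f) x) \<le> norm g * norm (f x)"
    using norm_mult_ineq[of "g x" "f x"] mult_right_mono[OF norm_bounded[of g x], of "norm (f x)"]
    by simp
qed

lemma vanishing_mult_right:
  fixes f g :: "'x::metric_space \<Rightarrow>\<^sub>C 'a::cstar_algebra"
  assumes "f \<in> vanishing_at_infinity" shows "f * g \<in> vanishing_at_infinity"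
proof (rule vanishing_dominated[OF assms, of _ "norm g"])
  fix x
  show "norm (apply_bcontfun (f * g) x) \<le> norm g * norm (f x)"
    using norm_mult_ineq[of "f x" "g x"] mult_left_mono[OF norm_bounded[of g x], of "norm (f x)"]
    by (simp add: mult.commute)
qed

lemma vanishing_scaleC:
  fixes f :: "'x::metric_space \<Rightarrow>\<^sub>C 'a::cstar_algebra"
  assumes "f \<in> vanishing_at_infinity" shows "c *\<^sub>C f \<in> vanishing_at_infinity"
  by (rule vanishing_dominated[OF assms, of _ "cmod c"]) (simp add: norm_scaleC)

lemma vanishing_star:
  fixes f :: "'x::metric_space \<Rightarrow>\<^sub>C 'a::cstar_algebra"
  assumes "f \<in> vanishing_at_infinity" shows "star f \<in> vanishing_at_infinity"
  by (rule vanishing_dominated[OF assms, of _ 1]) simp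

definition corona_rel ::
    "('x::metric_space \<Rightarrow>\<^sub>C 'a::cstar_algebra) \<Rightarrow> ('x \<Rightarrow>\<^sub>C 'a) \<Rightarrow> bool" where
  "corona_rel f g \<longleftrightarrow> f - g \<in> vanishing_at_infinity"

lemma equivp_corona_rel: "equivp corona_rel"
proof (rule equivpI)
  show "reflp corona_rel" by (rule reflpI) (simp add: corona_rel_def vanishing_zero)
  show "symp corona_rel"
    unfolding corona_rel_def by (rule sympI, drule vanishing_uminus) simp
  show "transp corona_rel"
    unfolding corona_rel_def by (rule transpI, drule (1) vanishing_add) simp
qed

lemma corona_rel_eqI: "f = g \<Longrightarrow> corona_rel f g"
  by (simp add: corona_rel_def vanishing_zero)

quotient_type (overloaded) ('x, 'a) corona =
  "'x::metric_space \<Rightarrow>\<^sub>C 'a::cstar_algebra" / corona_rel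
  by (rule equivp_corona_rel)

instantiation corona :: (metric_space, cstar_algebra) ab_group_add
begin

lift_definition zero_corona :: "('a, 'b) corona" is 0 .

lift_definition plus_corona :: "('a, 'b) corona \<Rightarrow> ('a, 'b) corona \<Rightarrow> ('a, 'b) corona" is "(+)"
  unfolding corona_rel_def by (simp add: add_diff_add vanishing_add)

lift_definition uminus_corona :: "('a, 'b) corona \<Rightarrow> ('a, 'b) corona" is uminus
  unfolding corona_rel_def by (metis minus_diff_minus vanishing_uminus)

definition minus_corona :: "('a, 'b) corona \<Rightarrow> ('a, 'b) corona \<Rightarrow> ('a, 'b) corona" where
  "minus_corona p q = p + - q"

instance
proof
  fix p q r :: "('a, 'b) corona"
  show "p + q + r = p + (q + r)" "p + q = q + p" "0 + p = p" "- p + p = 0"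
    by (transfer, rule corona_rel_eqI, simp add: algebra_simps)+
qed (rule minus_corona_def)

end

lemma abs_corona_diff: "abs_corona (f - g) = abs_corona f - abs_corona g"
  unfolding minus_corona_def plus_corona.abs_eq uminus_corona.abs_eq
  by (rule arg_cong[of _ _ abs_corona]) simp

lemma abs_corona_eq_0_iff: "abs_corona f = 0 \<longleftrightarrow> f \<in> vanishing_at_infinity"
  by (simp add: zero_corona_def corona.abs_eq_iff corona_rel_def)

instantiation corona :: (metric_space, cstar_algebra) real_algebra
begin

lift_definition times_corona :: "('a, 'b) corona \<Rightarrow> ('a, 'b) corona \<Rightarrow> ('a, 'b) corona" is "(*)"
proof -
  fix f f' g g' :: "'a \<Rightarrow>\<^sub>C 'b"
  assume "corona_rel f f'" "corona_rel g g'"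
  moreover have "f * g - f' * g' = (f - f') * g + f' * (g - g')" by (simp add: algebra_simps)
  ultimately show "corona_rel (f * g) (f' * g')"
    by (simp add: corona_rel_def vanishing_add vanishing_mult_left vanishing_mult_right)
qed

lift_definition scaleR_corona :: "real \<Rightarrow> ('a, 'b) corona \<Rightarrow> ('a, 'b) corona" is "(*\<^sub>R)"
  unfolding corona_rel_def by (metis scaleR_diff_right scaleR_scaleC vanishing_scaleC)

instance
proof
  fix p q r :: "('a, 'b) corona" and a b :: real
  show "a *\<^sub>R (p + q) = a *\<^sub>R p + a *\<^sub>R q" "(a + b) *\<^sub>R p = a *\<^sub>R p + b *\<^sub>R p"
    "a *\<^sub>R b *\<^sub>R p = (a * b) *\<^sub>R p" "1 *\<^sub>R p = p"
    "p * q * r = p * (q * r)" "(p + q) * r = p * r + q * r" "p * (q + r) = p * q + p * r"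
    "a *\<^sub>R p * q = a *\<^sub>R (p * q)" "p * a *\<^sub>R q = a *\<^sub>R (p * q)"
    by (transfer, rule corona_rel_eqI, simp add: algebra_simps)+
qed

end

instantiation corona :: (metric_space, cstar_algebra) real_normed_algebra
begin

text \<open>The quotient norm.\<close>

definition norm_corona :: "('a, 'b) corona \<Rightarrow> real" where
  "norm_corona p = (INF f\<in>{f. abs_corona f = p}. norm f)"

definition "sgn (p :: ('a, 'b) corona) = p /\<^sub>R norm p"

definition dist_corona :: "('a, 'b) corona \<Rightarrow> ('a, 'b) corona \<Rightarrow> real" where
  "dist_corona p q = norm (p - q)"

definition uniformity_corona :: "(('a, 'b) corona \<times> ('a, 'b) corona) filter" where
  "uniformity_corona = (INF e\<in>{0 <..}. principal {(x, y). dist x y < e})"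

definition open_corona :: "('a, 'b) corona set \<Rightarrow> bool" where
  "open_corona S = (\<forall>x\<in>S. \<forall>\<^sub>F (x', y) in uniformity. x' = x \<longrightarrow> y \<in> S)"

lemma abs_corona_surj: "\<exists>f. abs_corona f = (p :: ('a, 'b) corona)"
  using Quotient_abs_rep[OF Quotient_corona] by blast

lemma bdd_below_norm_lifts: "bdd_below (norm ` {f. abs_corona f = (p :: ('a, 'b) corona)})"
  by (rule bdd_belowI[of _ 0]) auto

lemma norm_abs_corona_le: "norm (abs_corona f :: ('a, 'b) corona) \<le> norm f"
  unfolding norm_corona_def by (rule cINF_lower[OF bdd_below_norm_lifts]) simp

lemma norm_corona_lift:
  assumes "norm (p :: ('a, 'b) corona) < e"
  obtains f where "abs_corona f = p" "norm f < e"
  using assms abs_corona_surj[of p] cINF_less_iff[OF _ bdd_below_norm_lifts]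
  unfolding norm_corona_def by blast

lemma norm_corona_nonneg: "0 \<le> norm (p :: ('a, 'b) corona)"
  unfolding norm_corona_def using abs_corona_surj[of p] by (intro cINF_greatest) auto

instance
proof
  fix p q :: "('a, 'b) corona" and a :: real
  show "norm p = 0 \<longleftrightarrow> p = 0"
  proof
    assume "p = 0"
    then have "norm p \<le> 0" using norm_abs_corona_le[of "0 :: 'a \<Rightarrow>\<^sub>C 'b"] by (simp add: zero_corona_def)
    then show "norm p = 0" using norm_corona_nonneg[of p] by simp
  next
    assume 0: "norm p = 0"
    obtain f where f: "abs_corona f = p" using abs_corona_surj by blast
    have "f \<in> vanishing_at_infinity"
    proof (rule vanishingI)
      fix e :: real assume e: "e > 0"
      obtain g where g: "abs_corona g = p" "norm g < e / 2"
        using norm_corona_lift[of p "e / 2"] 0 e by auto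
      have "f - g \<in> vanishing_at_infinity" using f g abs_corona_eq_0_iff[of "f - g"]
        by (simp add: abs_corona_diff)
      then obtain K where K: "compact K" "\<And>x. x \<notin> K \<Longrightarrow> norm (apply_bcontfun (f - g) x) < e / 2"
        using vanishingD[of "f - g" "e / 2"] e by auto
      have "norm (f x) < e" if "x \<notin> K" for x
        using K(2)[OF that] norm_bounded[of g x] g(2) norm_triangle_sub[of "f x" "g x"] by simp
      with K(1) show "\<exists>K. compact K \<and> (\<forall>x. x \<notin> K \<longrightarrow> norm (f x) < e)" by blast
    qed
    then show "p = 0" using f abs_corona_eq_0_iff[of f] by simp
  qed
  show "norm (p + q) \<le> norm p + norm q"
  proof (rule field_le_epsilon)
    fix e :: real assume e: "e > 0"
    obtain f where f: "abs_corona f = p" "norm f < norm p + e / 2"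
      using norm_corona_lift[of p "norm p + e / 2"] e by auto
    obtain g where g: "abs_corona g = q" "norm g < norm q + e / 2"
      using norm_corona_lift[of q "norm q + e / 2"] e by auto
    have "norm (p + q) \<le> norm (f + g)"
      using norm_abs_corona_le[of "f + g"] f g by (simp flip: plus_corona.abs_eq)
    then show "norm (p + q) \<le> norm p + norm q + e"
      using norm_triangle_ineq[of f g] f g by linarith
  qed
  have scale_le: "norm (a *\<^sub>R p) \<le> \<bar>a\<bar> * norm p" for a and p :: "('a, 'b) corona"
  proof (rule field_le_epsilon)
    fix e :: real assume e: "e > 0"
    then have "e / (\<bar>a\<bar> + 1) > 0" by (simp add: add_nonneg_pos)
    then obtain f where f: "abs_corona f = p" "norm f < norm p + e / (\<bar>a\<bar> + 1)"
      using norm_corona_lift[of p "norm p + e / (\<bar>a\<bar> + 1)"] by auto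
    have "norm (a *\<^sub>R p) \<le> \<bar>a\<bar> * norm f"
      using norm_abs_corona_le[of "a *\<^sub>R f"] f by (simp flip: scaleR_corona.abs_eq)
    also have "\<dots> \<le> \<bar>a\<bar> * (norm p + e / (\<bar>a\<bar> + 1))" using f by (intro mult_left_mono) auto
    also have "\<dots> \<le> \<bar>a\<bar> * norm p + e" using e by (simp add: field_simps add_nonneg_pos)
    finally show "norm (a *\<^sub>R p) \<le> \<bar>a\<bar> * norm p + e" .
  qed
  show "norm (a *\<^sub>R p) = \<bar>a\<bar> * norm p"
  proof (cases "a = 0")
    case True
    then show ?thesis using scale_le[of a p] norm_corona_nonneg[of "a *\<^sub>R p"] by simp
  next
    case False
    then have "norm p \<le> inverse \<bar>a\<bar> * norm (a *\<^sub>R p)"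
      using scale_le[of "inverse a" "a *\<^sub>R p"] by simp
    then show ?thesis using scale_le[of a p] False by (simp add: field_simps)
  qed
  show "norm (p * q) \<le> norm p * norm q"
  proof (rule field_le_epsilon)
    fix e :: real assume e: "e > 0"
    define d where "d = min 1 (e / (norm p + norm q + 1))"
    have pos: "norm p + norm q + 1 > 0"
      using norm_corona_nonneg[of p] norm_corona_nonneg[of q] by linarith
    have d: "d > 0" "d \<le> 1" using e pos by (simp_all add: d_def)
    have "d \<le> e / (norm p + norm q + 1)" by (simp add: d_def)
    then have de: "d * (norm p + norm q + 1) \<le> e" using pos by (simp only: pos_le_divide_eq)
    obtain f where f: "abs_corona f = p" "norm f < norm p + d"
      using norm_corona_lift[of p "norm p + d"] d by auto
    obtain g where g: "abs_corona g = q" "norm g < norm q + d"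
      using norm_corona_lift[of q "norm q + d"] d by auto
    have "norm (p * q) \<le> norm (f * g)"
      using norm_abs_corona_le[of "f * g"] f g by (simp flip: times_corona.abs_eq)
    also have "\<dots> \<le> norm f * norm g" by (rule norm_mult_ineq)
    also have "\<dots> \<le> (norm p + d) * (norm q + d)" 
      using f g d norm_corona_nonneg[of p] by (intro mult_mono) auto
    also have "\<dots> = norm p * norm q + d * (norm p + norm q + d)" by (simp add: algebra_simps)
    also have "\<dots> \<le> norm p * norm q + d * (norm p + norm q + 1)"
      using d by (intro add_left_mono mult_left_mono) auto
    also have "\<dots> \<le> norm p * norm q + e" using de by simp
    finally show "norm (p * q) \<le> norm p * norm q + e" .
  qed
qed (simp_all add: sgn_corona_def dist_corona_def uniformity_corona_def open_corona_def)

end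

lemma corona_lift_sequence:
  fixes X :: "nat \<Rightarrow> ('x::metric_space, 'a::cstar_algebra) corona"
  assumes "\<And>n. norm (X (Suc n) - X n) < (1/2) ^ n"
  shows "convergent X"
proof -
  have "\<exists>d. abs_corona d = X (Suc n) - X n \<and> norm d < (1/2) ^ n" for n
    using norm_corona_lift[OF assms[of n]] by metis
  then obtain d where d: "\<And>n. abs_corona (d n) = X (Suc n) - X n" "\<And>n. norm (d n) < (1/2) ^ n"
    by metis
  obtain f where f: "abs_corona f = X 0" using abs_corona_surj by blast
  have lift: "abs_corona (f + (\<Sum>i<n. d i)) = X n" for n
  proof (induction n)
    case (Suc n)
    have "abs_corona (f + (\<Sum>i<Suc n. d i)) = abs_corona (f + (\<Sum>i<n. d i)) + abs_corona (d n)"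
      by (simp add: plus_corona.abs_eq add.assoc)
    then show ?case by (simp add: Suc d)
  qed (simp add: f)
  have "summable d"
    by (rule summable_comparison_test'[where g = "\<lambda>n. (1/2) ^ n" and N = 0])
      (use d(2) in \<open>auto intro!: less_imp_le summable_geometric\<close>)
  then have lim: "(\<lambda>n. f + (\<Sum>i<n. d i)) \<longlonglongrightarrow> f + suminf d"
    by (intro tendsto_intros summable_LIMSEQ)
  have "X \<longlonglongrightarrow> abs_corona (f + suminf d)"
  proof (rule metric_tendsto_imp_tendsto[OF lim], rule always_eventually, rule allI)
    fix n
    show "dist (X n) (abs_corona (f + suminf d)) \<le> dist (f + (\<Sum>i<n. d i)) (f + suminf d)"
      unfolding dist_norm lift[of n, symmetric] abs_corona_diff[symmetric]
      by (rule norm_abs_corona_le)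
  qed
  then show ?thesis by (rule convergentI)
qed

instance corona :: (metric_space, cstar_algebra) banach
proof
  fix X :: "nat \<Rightarrow> ('a, 'b) corona" assume X: "Cauchy X"
  have "\<forall>k. \<exists>N. \<forall>m\<ge>N. \<forall>n\<ge>N. norm (X m - X n) < (1/2) ^ k"
    by (intro allI CauchyD[OF X]) simp
  from choice[OF this] obtain N
    where N: "\<And>k m n. m \<ge> N k \<Longrightarrow> n \<ge> N k \<Longrightarrow> norm (X m - X n) < (1/2) ^ k" by blast
  define r where "r = rec_nat (N 0) (\<lambda>k m. max (Suc m) (N (Suc k)))"
  have rS: "r (Suc k) = max (Suc (r k)) (N (Suc k))" for k by (simp add: r_def)
  have r0: "r 0 = N 0" by (simp add: r_def)
  have ge: "r k \<ge> N k" for k by (cases k) (simp_all add: r0 rS)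
  have mono: "strict_mono r" unfolding strict_mono_Suc_iff by (simp add: rS less_max_iff_disj)
  have "norm ((X \<circ> r) (Suc k) - (X \<circ> r) k) < (1/2) ^ k" for k
    unfolding o_def by (rule N) (use ge[of k] in \<open>simp_all add: rS le_max_iff_disj\<close>)
  then have "convergent (X \<circ> r)" by (rule corona_lift_sequence)
  then obtain L where "(X \<circ> r) \<longlonglongrightarrow> L" by (auto simp: convergent_def)
  then have "X \<longlonglongrightarrow> L" by (rule Cauchy_converges_subseq[OF X mono])
  then show "convergent X" by (rule convergentI)
qed

instantiation corona :: (metric_space, cstar_algebra) cstar_algebra
begin

lift_definition scaleC_corona :: "complex \<Rightarrow> ('a, 'b) corona \<Rightarrow> ('a, 'b) corona" is "(*\<^sub>C)"
  unfolding corona_rel_def by (metis scaleC_diff_right vanishing_scaleC)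

lift_definition star_corona :: "('a, 'b) corona \<Rightarrow> ('a, 'b) corona" is star
  unfolding corona_rel_def by (metis star_diff vanishing_star)

lemma norm_corona_square_le:
  fixes f g :: "'a \<Rightarrow>\<^sub>C 'b"
  assumes "abs_corona g = abs_corona (star f * f)"
  shows "(norm (abs_corona f))\<^sup>2 \<le> norm g"
proof (rule field_le_epsilon)
  fix e :: real assume e: "e > 0"
  define c where "c = sqrt (norm g + e)"
  have c: "c > 0" "c\<^sup>2 = norm g + e" using e by (auto simp: c_def add_nonneg_pos add_nonneg_nonneg)
  have van: "star f * f - g \<in> vanishing_at_infinity"
    using assms abs_corona_eq_0_iff[of "star f * f - g"] by (simp add: abs_corona_diff)
  obtain K where K: "compact K"
      "\<And>x. x \<notin> K \<Longrightarrow> norm (apply_bcontfun (star f * f - g) x) < e"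
    using vanishingD[OF van e] by blast
  have fc: "norm (f x) \<le> c" if "x \<notin> K" for x
  proof -
    have "(norm (f x))\<^sup>2 = norm (star (f x) * f x)" by (simp add: cstar_identity)
    also have "\<dots> \<le> norm (g x) + norm (star (f x) * f x - g x)" by (rule norm_triangle_sub)
    also have "\<dots> \<le> c\<^sup>2" using K(2)[OF that] norm_bounded[of g x] c(2) by simp
    finally show ?thesis by (rule power2_le_imp_le) (use c(1) in simp)
  qed
  define h where "h x = (c / max c (norm (f x))) *\<^sub>R f x" for x
  have hb: "norm (h x) \<le> c" for x
    using c(1) by (auto simp: h_def max_def divide_simps)
  have mpos: "max c (norm (f x)) \<noteq> 0" for x using c(1) by linarith
  have "h \<in> bcontfun"
    by (rule bcontfun_normI[OF _ hb])
      (use mpos in \<open>auto simp: h_def intro!: continuous_intros\<close>)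
  then obtain h' where h': "h = apply_bcontfun h'" by (rule bcontfunE)
  have "h' - f \<in> vanishing_at_infinity"
  proof (rule vanishingI)
    fix d :: real assume "d > 0"
    then have "norm (apply_bcontfun (h' - f) x) < d" if "x \<notin> K" for x
      using fc[OF that] c(1) by (simp add: h'[symmetric] h_def max_absorb1)
    with K(1) show "\<exists>K. compact K \<and> (\<forall>x. x \<notin> K \<longrightarrow> norm (apply_bcontfun (h' - f) x) < d)" by blast
  qed
  then have "abs_corona f = abs_corona h'" 
    using abs_corona_eq_0_iff[of "h' - f"] by (simp add: abs_corona_diff)
  then have "norm (abs_corona f) \<le> norm h'" using norm_abs_corona_le[of h'] by simp
  also have "\<dots> \<le> c" using hb unfolding h' by (rule norm_bound)
  finally have "(norm (abs_corona f))\<^sup>2 \<le> c\<^sup>2" by (rule power_mono) simp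
  then show "(norm (abs_corona f))\<^sup>2 \<le> norm g + e" using c by simp
qed

instance
proof
  fix p q :: "('a, 'b) corona" and r :: real and c d :: complex
  show "c *\<^sub>C (p + q) = c *\<^sub>C p + c *\<^sub>C q" "(c + d) *\<^sub>C p = c *\<^sub>C p + d *\<^sub>C p"
    "r *\<^sub>R p = complex_of_real r *\<^sub>C p"
    "(c *\<^sub>C p) * q = c *\<^sub>C (p * q)" "p * (c *\<^sub>C q) = c *\<^sub>C (p * q)"
    "star (star p) = p" "star (p + q) = star p + star q" "star (p * q) = star q * star p"
    "star (c *\<^sub>C p) = cnj c *\<^sub>C star p"
    by (transfer, rule corona_rel_eqI, simp add: scaleC_add_right scaleC_add_left
      scaleR_scaleC mult_scaleC_left mult_scaleC_right star_star star_add star_mult star_scaleC)+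
  show assoc: "c *\<^sub>C d *\<^sub>C p = (c * d) *\<^sub>C p" for c d and p :: "('a, 'b) corona"
    by (transfer, rule corona_rel_eqI, simp add: scaleC_scaleC)
  have one: "1 *\<^sub>C p = p"
    by (transfer, rule corona_rel_eqI, simp)
  have scale_le: "norm (c *\<^sub>C p) \<le> cmod c * norm p" for c and p :: "('a, 'b) corona"
  proof (rule field_le_epsilon)
    fix e :: real assume e: "e > 0"
    then have "e / (cmod c + 1) > 0" by (simp add: add_nonneg_pos)
    then obtain f where f: "abs_corona f = p" "norm f < norm p + e / (cmod c + 1)"
      using norm_corona_lift[of p "norm p + e / (cmod c + 1)"] by auto
    have "norm (c *\<^sub>C p) \<le> cmod c * norm f"
      using norm_abs_corona_le[of "c *\<^sub>C f"] f by (simp add: norm_scaleC flip: scaleC_corona.abs_eq)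
    also have "\<dots> \<le> cmod c * (norm p + e / (cmod c + 1))" using f by (intro mult_left_mono) auto
    also have "cmod c * (e / (cmod c + 1)) \<le> (cmod c + 1) * (e / (cmod c + 1))"
      using e by (intro mult_right_mono) auto
    then have "cmod c * (norm p + e / (cmod c + 1)) \<le> cmod c * norm p + e"
      using add_nonneg_pos[OF norm_ge_zero[of c] zero_less_one] by (simp add: distrib_left)
    finally show "norm (c *\<^sub>C p) \<le> cmod c * norm p + e" .
  qed
  show "norm (c *\<^sub>C p) = cmod c * norm p"
  proof (cases "c = 0")
    case True
    then show ?thesis using scale_le[of c p] by simp
  next
    case False
    then have "norm p \<le> inverse (cmod c) * norm (c *\<^sub>C p)"
      using scale_le[of "inverse c" "c *\<^sub>C p"] by (simp add: assoc one norm_inverse)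
    then show ?thesis using scale_le[of c p] False by (simp add: field_simps)
  qed
  have star_le: "norm (star p) \<le> norm p"
  proof (rule field_le_epsilon)
    fix e :: real assume e: "e > 0"
    then obtain f where f: "abs_corona f = p" "norm f < norm p + e"
      using norm_corona_lift[of p "norm p + e"] by auto
    have "norm (star p) \<le> norm f"
      using norm_abs_corona_le[of "star f"] f by (simp flip: star_corona.abs_eq)
    then show "norm (star p) \<le> norm p + e" using f by simp
  qed
  show "norm (star p * p) = (norm p)\<^sup>2"
  proof (rule antisym)
    show "norm (star p * p) \<le> (norm p)\<^sup>2"
      using norm_mult_ineq[of "star p" p] mult_right_mono[OF star_le norm_ge_zero[of p]]
      by (simp add: power2_eq_square)
    obtain f where f: "abs_corona f = p" using abs_corona_surj by blast
    have sf: "abs_corona (star f * f) = star p * p"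
      unfolding f[symmetric] times_corona.abs_eq star_corona.abs_eq ..
    show "(norm p)\<^sup>2 \<le> norm (star p * p)"
    proof (rule field_le_epsilon)
      fix e :: real assume "e > 0"
      then obtain g where g: "abs_corona g = star p * p" "norm g < norm (star p * p) + e"
        using norm_corona_lift[of "star p * p" "norm (star p * p) + e"] by auto
      have "(norm p)\<^sup>2 \<le> norm g" using norm_corona_square_le[of g f] f g sf by simp
      then show "(norm p)\<^sup>2 \<le> norm (star p * p) + e" using g by simp
    qed
  qed
qed

end


section \<open>Flexible spaces\<close>

definition Homeo_bd :: "'x::topological_space set \<Rightarrow> ('x \<Rightarrow> 'x) set" where
  "Homeo_bd Y = {\<phi>. (\<exists>\<psi>. homeomorphism Y Y \<phi> \<psi>) \<and> (\<forall>y\<in>Y \<inter> closure (- Y). \<phi> y = y)}"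

text \<open>With values in the extended nonnegative reals, so that the supremum over the empty set is \<open>0\<close>.\<close>

definition radius :: "'x::metric_space set \<Rightarrow> ('x \<Rightarrow> 'x) \<Rightarrow> ennreal" where
  "radius Y \<phi> = (SUP y\<in>Y. ennreal (dist y (\<phi> y)))"

text \<open>Polishness concerns the topology only; the metric of the type need not be complete.\<close>

definition flexible_space :: "'x::metric_space itself \<Rightarrow> bool" where
  "flexible_space _ \<longleftrightarrow>
    separable_space (euclidean :: 'x topology) \<and>
    completely_metrizable_space (euclidean :: 'x topology) \<and>
    locally_compact_space (euclidean :: 'x topology) \<and>
    \<not> compact (UNIV :: 'x set) \<and>
    (\<exists>(Y :: nat \<Rightarrow> 'x set) (\<phi> :: nat \<Rightarrow> nat \<Rightarrow> 'x \<Rightarrow> 'x).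
      disjoint_family Y \<and>
      (\<forall>n m. \<phi> n m \<in> Homeo_bd (Y n)) \<and>
      (\<forall>n. compact (Y n)) \<and>
      (\<forall>K. compact K \<longrightarrow> finite {n. K \<inter> Y n \<noteq> {}}) \<and>
      (\<forall>n. decseq (\<lambda>m. radius (Y n) (\<phi> n m)) \<and>
           (\<lambda>m. radius (Y n) (\<phi> n m)) \<longlonglongrightarrow> 0 \<and>
           (\<forall>m. radius (Y n) (\<phi> n m) \<noteq> 0)))"


section \<open>Cardinals\<close>

abbreviation aleph_0 :: "nat rel" (\<open>\<aleph>\<^sub>0\<close>) where "\<aleph>\<^sub>0 \<equiv> natLeq"
abbreviation aleph_1 :: "nat set rel" (\<open>\<aleph>\<^sub>1\<close>) where "\<aleph>\<^sub>1 \<equiv> cardSuc natLeq"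
abbreviation continuum :: "(nat \<Rightarrow> bool) rel" (\<open>\<cc>\<close>) where "\<cc> \<equiv> ctwo ^c natLeq"

definition CH :: bool where "CH \<longleftrightarrow> \<cc> =o \<aleph>\<^sub>1"

definition cofinal_family :: "(nat \<Rightarrow> nat) set \<Rightarrow> bool" where
  "cofinal_family F \<longleftrightarrow> (\<forall>f. \<exists>g\<in>F. \<forall>\<^sub>\<infinity>n. f n \<le> g n)"

definition least_cofinal_card :: "(nat \<Rightarrow> nat) rel \<Rightarrow> bool" where
  "least_cofinal_card r \<longleftrightarrow>
    (\<exists>F. cofinal_family F \<and> r = |F| ) \<and> (\<forall>G. cofinal_family G \<longrightarrow> r \<le>o |G| )"

definition dominating_number :: "(nat \<Rightarrow> nat) rel" (\<open>\<dd>\<close>) where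
  "\<dd> = (SOME r. least_cofinal_card r)"

lemma least_cofinal_card_dominating_number: "least_cofinal_card \<dd>"
proof -
  define R where "R = {|F| | F. cofinal_family F}"
  have "cofinal_family UNIV"
    unfolding cofinal_family_def by (metis UNIV_I order_refl MOST_I)
  then have "R \<noteq> {}" unfolding R_def by blast
  moreover have "\<forall>r\<in>R. Card_order r" unfolding R_def using card_of_Card_order by blast
  ultimately obtain r where "r \<in> R" "\<forall>s\<in>R. r \<le>o s"
    using exists_minim_Card_order by blast
  then have "least_cofinal_card r" unfolding least_cofinal_card_def R_def by blast
  then show ?thesis unfolding dominating_number_def by (rule someI)
qed

end

theory Submission
  imports Defs
begin

text \<open>
  A homeomorphism of \<open>X\<close> glued from homeomorphisms of the pieces \<open>Y\<^sub>n\<close> acts on \<open>Q(X,A)\<close>, and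
  two of them act in the same way on all functions whose modulus of continuity on \<open>Y\<^sub>n\<close> is
  controlled at a scale \<open>r\<^sub>n\<close> at which the two are uniformly close. Pairs consisting of a glued
  homeomorphism and a scale are ordered like nested balls, modulo finitely many \<open>n\<close>. This order is
  \<open>\<sigma>\<close>-closed by diagonalisation, and every pair has two refinements of prescribed scale that act
  differently on some function controlled by both, namely the ones differing by a tiny nontrivial
  homeomorphism on each \<open>Y\<^sub>n\<close>. Hence there is a binary tree of height \<open>\<omega>\<^sub>1\<close> of such pairs. If its
  levels are made to run through a dominating family of scales, then every function is controlled
  somewhere along each branch, so each of the \<open>2\<close>-to-the-\<open>\<omega>\<^sub>1\<close> branches defines an automorphism,
  and different branches define different ones.
\<close>

section \<open>Chains modulo finite sets and trees of chains\<close>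

text \<open>Diagonal argument: an enumerated chain has an increasing cofinal sequence
  \<open>z\<close>, and following \<open>z\<close> slowly enough gives a bound. Each coordinate of
  the bound is a coordinate of some member of \<open>C\<close>, so it lies in \<open>A n\<close>
  without any passage to a limit.\<close>

lemma countable_chain_upper_bound_mod_finite:
  fixes le :: "nat \<Rightarrow> 'p \<Rightarrow> 'p \<Rightarrow> bool"
  assumes refl: "\<And>n x. le n x x"
    and trans: "\<And>n x y z. le n x y \<Longrightarrow> le n y z \<Longrightarrow> le n x z"
    and nonempty: "\<And>n. A n \<noteq> {}"
    and C: "countable C" "\<And>c n. c \<in> C \<Longrightarrow> c n \<in> A n"
    and chain: "\<And>c d. c \<in> C \<Longrightarrow> d \<in> C \<Longrightarrow>
      (\<forall>\<^sub>\<infinity>n. le n (c n) (d n)) \<or> (\<forall>\<^sub>\<infinity>n. le n (d n) (c n))"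
  shows "\<exists>u. (\<forall>n. u n \<in> A n) \<and> (\<forall>c\<in>C. \<forall>\<^sub>\<infinity>n. le n (c n) (u n))"
proof (cases "C = {}")
  case True
  have "\<exists>u. \<forall>n. u n \<in> A n" by (intro choice) (use nonempty in blast)
  with True show ?thesis by auto
next
  case False
  define LE where "LE s t \<longleftrightarrow> (\<forall>\<^sub>\<infinity>n. le n (s n) (t n))" for s t
  have LE_refl: "LE s s" for s by (simp add: LE_def refl)
  have LE_trans: "LE s u" if "LE s t" "LE t u" for s t u
    using that unfolding LE_def by eventually_elim (rule trans)
  define c where "c = from_nat_into C"
  have rc: "range c = C" unfolding c_def by (rule range_from_nat_into[OF False C(1)])
  then have cC: "c k \<in> C" for k by auto
  define z where "z = rec_nat (c 0) (\<lambda>k w. if LE w (c (Suc k)) then c (Suc k) else w)"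
  have z0: "z 0 = c 0" and zS: "z (Suc k) = (if LE (z k) (c (Suc k)) then c (Suc k) else z k)" for k
    by (simp_all add: z_def)
  have zC: "z k \<in> C" for k by (induction k) (auto simp: z0 zS cC)
  have cz: "LE (c k) (z k)" for k
  proof (cases k)
    case (Suc m)
    have "LE (z m) (c k) \<or> LE (c k) (z m)" using chain[OF zC cC] by (simp add: LE_def)
    with Suc show ?thesis by (auto simp: zS LE_refl)
  qed (simp add: z0 LE_refl)
  have zz: "LE (z j) (z k)" if "j \<le> k" for j k
    using that by (induction rule: dec_induct) (auto simp: zS LE_refl intro: LE_trans)
  \<comment> \<open>Follow the cofinal sequence \<open>z\<close> so slowly that \<open>z (K n)\<close> already dominates
    \<open>c 0, \<dots>, c (K n)\<close> at the coordinate \<open>n\<close>.\<close>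
  define good where "good n k \<longleftrightarrow> (\<forall>i\<le>k. le n (c i n) (z k n))" for n k
  define K where "K n = Max {k. k \<le> n \<and> good n k}" for n
  have cand: "finite {k. k \<le> n \<and> good n k}" "0 \<in> {k. k \<le> n \<and> good n k}" for n
    by (auto simp: good_def z0 refl)
  have K: "good n (K n)" for n using Max_in[OF cand(1), of n] cand(2)[of n] unfolding K_def by blast
  have "\<forall>\<^sub>\<infinity>n. le n (c j n) (z (K n) n)" for j
  proof -
    have "\<forall>\<^sub>\<infinity>n. le n (c i n) (z j n)" if "i \<le> j" for i
      using LE_trans[OF cz zz[OF that]] by (simp add: LE_def)
    then have "\<forall>\<^sub>\<infinity>n. \<forall>i\<in>{..j}. le n (c i n) (z j n)"
      by (simp add: eventually_ball_finite_distrib cofinite_eq_sequentially)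
    then have "\<forall>\<^sub>\<infinity>n. good n j" by (simp add: good_def Ball_def)
    moreover have "\<forall>\<^sub>\<infinity>n. j \<le> n" by (simp add: cofinite_eq_sequentially)
    ultimately show ?thesis
    proof eventually_elim
      case (elim n)
      then have "j \<le> K n" unfolding K_def by (intro Max_ge) (use cand in auto)
      then show ?case using K[of n] by (simp add: good_def)
    qed
  qed
  then have "\<forall>d\<in>C. \<forall>\<^sub>\<infinity>n. le n (d n) (z (K n) n)" using rc by auto
  moreover have "z (K n) n \<in> A n" for n by (rule C(2)[OF zC])
  ultimately show ?thesis by (intro exI[of _ "\<lambda>n. z (K n) n"]) blast
qed

text \<open>Transfinite recursion along \<open>r\<close>: the node at \<open>i\<close> is one of two
  refinements, provided by \<open>split\<close>, of an upper bound of the earlier nodes, and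
  \<open>p i\<close> says which. Initial segments are countable, so \<open>closed\<close> supplies
  the bound. Where two branches first disagree their earlier nodes coincide, so both refine the same
  bound and \<open>Q\<close> holds.\<close>

lemma binary_tree_of_chains:
  fixes r :: "'i rel" and le :: "'s \<Rightarrow> 's \<Rightarrow> bool"
  assumes wo: "Well_order r" and small: "\<And>i. countable (underS r i)"
    and refl: "\<And>s. le s s" and trans: "\<And>s t u. le s t \<Longrightarrow> le t u \<Longrightarrow> le s u"
    and closed: "\<And>C. countable C \<Longrightarrow> C \<subseteq> P \<Longrightarrow> (\<And>s t. s \<in> C \<Longrightarrow> t \<in> C \<Longrightarrow> le s t \<or> le t s) \<Longrightarrow>
      \<exists>u\<in>P. \<forall>s\<in>C. le s u"
    and split: "\<And>i s. s \<in> P \<Longrightarrow> \<exists>t. (\<forall>b. t b \<in> P \<and> le s (t b) \<and> E i (t b)) \<and> Q (t True) (t False)"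
    and sym: "\<And>s t. Q s t \<Longrightarrow> Q t s"
  obtains S :: "('i \<Rightarrow> bool) \<Rightarrow> 'i \<Rightarrow> 's"
  where "\<And>p i. S p i \<in> P" "\<And>p i. E i (S p i)" "\<And>p i j. (i, j) \<in> r \<Longrightarrow> le (S p i) (S p j)"
    "\<And>p q i. i \<in> Field r \<Longrightarrow> p i \<noteq> q i \<Longrightarrow> \<exists>j\<in>Field r. Q (S p j) (S q j)"
proof -
  have wf: "wf (r - Id)" using wo by (simp add: well_order_on_def)
  \<comment> \<open>\<open>ub\<close> depends only on the set of earlier nodes, so branches that
    agree below \<open>i\<close> get the same bound at \<open>i\<close>.\<close>
  define ub where "ub C = (SOME u. u \<in> P \<and> (\<forall>s\<in>C. le s u))" for C
  define sp where "sp i s = (SOME t. (\<forall>b. t b \<in> P \<and> le s (t b) \<and> E i (t b)) \<and> Q (t True) (t False))" for i s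
  define S where "S p = wfrec (r - Id) (\<lambda>f i. sp i (ub (f ` underS r i)) (p i))" for p
  have S: "S p i = sp i (ub (S p ` underS r i)) (p i)" for p i
  proof -
    have "cut (S p) (r - Id) i ` underS r i = S p ` underS r i"
      by (rule image_cong) (auto simp: cut_apply underS_def)
    then show ?thesis unfolding S_def by (subst wfrec[OF wf]) simp
  qed
  have sp: "sp i s b \<in> P" "le s (sp i s b)" "E i (sp i s b)" "Q (sp i s True) (sp i s False)"
    if "s \<in> P" for i s b
    using someI_ex[OF split[OF that, of i]] unfolding sp_def by blast+
  have compar: "j = k \<or> j \<in> underS r k \<or> k \<in> underS r j" if "j \<in> Field r" "k \<in> Field r" for j k
    using wo that unfolding well_order_on_def linear_order_on_def total_on_def underS_def by blast
  have under_Field: "j \<in> Field r" if "j \<in> underS r i" for i j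
    using that by (auto simp: underS_def Field_def)
  have main: "S p i \<in> P \<and> (\<forall>j\<in>underS r i. le (S p j) (S p i)) \<and>
      ub (S p ` underS r i) \<in> P" for p i
  proof (induction i rule: wf_induct_rule[OF wf])
    case (1 i)
    have IH: "S p j \<in> P" "\<forall>k\<in>underS r j. le (S p k) (S p j)" if "j \<in> underS r i" for j
      using 1[of j] that by (auto simp: underS_def)
    have "\<exists>u\<in>P. \<forall>s\<in>S p ` underS r i. le s u"
    proof (rule closed)
      fix s t assume "s \<in> S p ` underS r i" "t \<in> S p ` underS r i"
      then show "le s t \<or> le t s"
        using IH(2) compar under_Field refl by (smt (verit) imageE)
    qed (use small IH in auto)
    then have "\<exists>u. u \<in> P \<and> (\<forall>s\<in>S p ` underS r i. le s u)" by blast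
    from someI_ex[OF this, folded ub_def]
    have u: "ub (S p ` underS r i) \<in> P" "\<forall>s\<in>S p ` underS r i. le s (ub (S p ` underS r i))"
      by blast+
    with sp(1,2)[OF u(1)] show ?case by (subst (1 3) S) (blast intro: trans)
  qed
  show thesis
  proof
    show "S p i \<in> P" for p i using main by blast
    show "E i (S p i)" for p i by (subst S) (use main sp(3) in blast)
    show "le (S p i) (S p j)" if "(i, j) \<in> r" for p i j
      using main[of p j] refl that by (cases "i = j") (auto simp: underS_def)
    show "\<exists>j\<in>Field r. Q (S p j) (S q j)" if "i \<in> Field r" "p i \<noteq> q i" for p q i
    proof -
      have "i \<in> {j \<in> Field r. p j \<noteq> q j}" using that by simp
      then obtain m where m: "m \<in> {j \<in> Field r. p j \<noteq> q j}"
        and least: "\<And>y. (y, m) \<in> r - Id \<Longrightarrow> y \<notin> {j \<in> Field r. p j \<noteq> q j}"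
        by (rule wfE_min[OF wf]) blast
      have eq: "S p j = S q j" if "(j, m) \<in> r - Id" for j
        using that
      proof (induction j rule: wf_induct_rule[OF wf])
        case (1 j)
        have jm: "j \<noteq> m" "(j, m) \<in> r" using 1(2) by auto
        have tr: "trans r" "antisym r"
          using wo by (auto simp: well_order_on_def linear_order_on_def partial_order_on_def preorder_on_def)
        have "S p k = S q k" if "k \<in> underS r j" for k
        proof (rule 1(1))
          show "(k, j) \<in> r - Id" using that by (auto simp: underS_def)
          show "(k, m) \<in> r - Id"
            using that jm tr unfolding underS_def by (auto dest: transD antisymD)
        qed
        then have "S p ` underS r j = S q ` underS r j" by (rule image_cong[OF HOL.refl])
        moreover have "p j = q j" using least[OF 1(2)] jm by (auto simp: Field_def)
        ultimately show ?case by (subst (1 2) S) simp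
      qed
      have im: "S p ` underS r m = S q ` underS r m"
        by (rule image_cong) (auto simp: underS_def intro: eq)
      have "ub (S q ` underS r m) \<in> P" using main by blast
      note Q = sp(4)[OF this, of m]
      have "Q (S p m) (S q m)"
        using m Q sym[OF Q] by (subst (1 2) S) (cases "p m"; cases "q m"; simp add: im)
      with m show ?thesis by blast
    qed
  qed
qed

section \<open>Homeomorphisms glued from pieces\<close>

text \<open>The inverse is carried along so that refinements control it as well. The datatype
  imposes no laws; \<open>pieces\<close> adds them.\<close>

datatype 'x piece = Piece (fwd: "'x \<Rightarrow> 'x") (bwd: "'x \<Rightarrow> 'x") (rad: real)

text \<open>The order is that of nested balls \<open>B(p, rad p) \<supseteq> B(q, rad q)\<close>, for the metric that
  compares both the homeomorphisms and their inverses.\<close>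

definition piece_le :: "'x::metric_space set \<Rightarrow> 'x piece \<Rightarrow> 'x piece \<Rightarrow> bool" where
  "piece_le Y p q \<longleftrightarrow> rad q \<le> rad p \<and>
    (\<forall>y\<in>Y. dist (fwd p y) (fwd q y) + rad q \<le> rad p \<and> dist (bwd p y) (bwd q y) + rad q \<le> rad p)"

lemma piece_le_refl: "piece_le Y p p"
  by (simp add: piece_le_def)

lemma piece_le_trans:
  assumes "piece_le Y p q" "piece_le Y q r" shows "piece_le Y p r"
  unfolding piece_le_def
proof (intro conjI ballI)
  show "rad r \<le> rad p" using assms by (simp add: piece_le_def)
  fix y assume "y \<in> Y"
  then show "dist (fwd p y) (fwd r y) + rad r \<le> rad p" "dist (bwd p y) (bwd r y) + rad r \<le> rad p"
    using assms dist_triangle[of "fwd p y" "fwd r y" "fwd q y"]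
      dist_triangle[of "bwd p y" "bwd r y" "bwd q y"]
    unfolding piece_le_def by (smt (verit))+
qed

text \<open>Passage to the inverse homeomorphisms at the same scales. As \<open>piece_le\<close>
  treats both directions alike, a flipped chain is again a chain; it yields the inverse
  automorphism.\<close>

definition flip :: "(nat \<Rightarrow> 'x piece) \<Rightarrow> nat \<Rightarrow> 'x piece" where
  "flip s n = Piece (bwd (s n)) (fwd (s n)) (rad (s n))"

lemma flip_simps [simp]: "fwd (flip s n) = bwd (s n)" "bwd (flip s n) = fwd (s n)" "rad (flip s n) = rad (s n)"
  by (simp_all add: flip_def)

lemma flip_flip [simp]: "flip (flip s) = s"
  by (rule ext) (simp add: flip_def)

lemma abs_corona_eq_iff: "abs_corona F = abs_corona G \<longleftrightarrow> F - G \<in> vanishing_at_infinity"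
  using abs_corona_eq_0_iff[of "F - G"] by (simp add: abs_corona_diff)

locale flexible_pieces =
  fixes Y :: "nat \<Rightarrow> 'x::metric_space set"
  assumes disjoint: "disjoint_family Y"
    and compact: "\<And>n. compact (Y n)"
    and finite_meet: "\<And>K. compact K \<Longrightarrow> finite {n. K \<inter> Y n \<noteq> {}}"
    and locally_compact: "locally_compact_space (euclidean :: 'x topology)"
begin

text \<open>Fixing the boundary points permits gluing with the identity outside; a positive radius
  leaves room for further refinement.\<close>

definition pieces :: "nat \<Rightarrow> 'x piece set" where
  "pieces n = {p. homeomorphism (Y n) (Y n) (fwd p) (bwd p) \<and>
    (\<forall>y\<in>Y n \<inter> closure (- Y n). fwd p y = y \<and> bwd p y = y) \<and> rad p > 0}"

definition states :: "(nat \<Rightarrow> 'x piece) set" where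
  "states = {s. \<forall>n. s n \<in> pieces n}"

definition le :: "(nat \<Rightarrow> 'x piece) \<Rightarrow> (nat \<Rightarrow> 'x piece) \<Rightarrow> bool" where
  "le s t \<longleftrightarrow> (\<forall>\<^sub>\<infinity>n. piece_le (Y n) (s n) (t n))"

definition glue :: "(nat \<Rightarrow> 'x \<Rightarrow> 'x) \<Rightarrow> 'x \<Rightarrow> 'x" where
  "glue h x = (if \<exists>n. x \<in> Y n then h (THE n. x \<in> Y n) x else x)"

definition act :: "(nat \<Rightarrow> 'x piece) \<Rightarrow> ('x \<Rightarrow>\<^sub>C 'a::cstar_algebra) \<Rightarrow> 'x \<Rightarrow>\<^sub>C 'a" where
  "act s F = Bcontfun (\<lambda>x. F (glue (\<lambda>n. fwd (s n)) x))"

text \<open>The bound serves as a null sequence: errors of this size on \<open>Y n\<close> vanish at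
  infinity.\<close>

definition controlled :: "(nat \<Rightarrow> 'x piece) \<Rightarrow> ('x \<Rightarrow>\<^sub>C 'a::cstar_algebra) \<Rightarrow> bool" where
  "controlled s F \<longleftrightarrow> (\<forall>\<^sub>\<infinity>n. \<forall>x\<in>Y n. \<forall>y\<in>Y n. dist x y \<le> rad (s n) \<longrightarrow>
    norm (F x - F y) \<le> inverse (real (Suc n)))"

lemma le_refl: "le s s"
  by (simp add: le_def piece_le_refl)

lemma le_trans: assumes "le s t" "le t u" shows "le s u"
  using assms unfolding le_def by eventually_elim (rule piece_le_trans)

lemma le_flip [simp]: "le (flip s) (flip t) \<longleftrightarrow> le s t"
  by (simp add: le_def piece_le_def conj_commute)

lemma pieces_nonempty: "pieces n \<noteq> {}"
proof -
  have "Piece id id 1 \<in> pieces n" by (simp add: pieces_def homeomorphism_ident[folded id_def])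
  then show ?thesis by blast
qed

lemma flip_states [simp]: "flip s \<in> states \<longleftrightarrow> s \<in> states"
proof -
  have "flip s \<in> states" if "s \<in> states" for s
    using that by (simp add: states_def pieces_def homeomorphism_symD)
  from this[of s] this[of "flip s"] show ?thesis by auto
qed

lemma controlled_flip [simp]: "controlled (flip s) F \<longleftrightarrow> controlled s F"
  by (simp add: controlled_def)

lemma controlled_mono: assumes "le s t" "controlled s F" shows "controlled t F"
  using assms unfolding le_def controlled_def by eventually_elim (auto simp: piece_le_def)

section \<open>Continuity of glued homeomorphisms\<close>

lemma glue_on: "x \<in> Y n \<Longrightarrow> glue h x = h n x"
proof -
  assume x: "x \<in> Y n"
  then have "(THE n. x \<in> Y n) = n"
    using disjoint by (intro the_equality) (auto simp: disjoint_family_on_def)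
  with x show ?thesis by (auto simp: glue_def)
qed

lemma glue_off: "(\<And>n. x \<notin> Y n) \<Longrightarrow> glue h x = x"
  by (simp add: glue_def)

lemma locally_finite:
  obtains V where "open V" "x \<in> V" "finite {n. Y n \<inter> V \<noteq> {}}"
proof -
  have "\<exists>V. open V \<and> (\<exists>K. compact K \<and> x \<in> V \<and> V \<subseteq> K)"
    using locally_compact by (simp add: locally_compact_space_def)
  then obtain V K where VK: "open V" "compact K" "x \<in> V" "V \<subseteq> K" by blast
  then have "{n. Y n \<inter> V \<noteq> {}} \<subseteq> {n. K \<inter> Y n \<noteq> {}}" by blast
  then show thesis using that VK finite_meet finite_subset by metis
qed

text \<open>The pieces and the closure of the complement of their union form a locally finite closed
  cover, so the pasting lemma applies. Distinct pieces are disjoint, and a point of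
  \<open>Y n\<close> in that closure is a boundary point of \<open>Y n\<close>, hence fixed by
  \<open>h n\<close>.\<close>

lemma continuous_glue:
  assumes "\<And>n. continuous_on (Y n) (h n)"
    and fix_bd: "\<And>n y. y \<in> Y n \<Longrightarrow> y \<in> closure (- Y n) \<Longrightarrow> h n y = y"
  shows "continuous_on UNIV (glue h)"
proof -
  \<comment> \<open>\<open>None\<close> indexes the closed set \<open>?Z\<close>, on which the glued
    map is the identity.\<close>
  let ?Z = "closure (- (\<Union>n. Y n))"
  let ?T = "case_option ?Z Y" and ?f = "case_option id h"
  have bd: "h n x = x" if "x \<in> ?Z" "x \<in> Y n" for x n
    using that fix_bd closure_mono[of "- (\<Union>n. Y n)" "- Y n"] by blast
  have same: "n = m" if "x \<in> Y n" "x \<in> Y m" for x n m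
    using that disjoint by (auto simp: disjoint_family_on_def)
  have "continuous_map euclidean euclidean (glue h)"
  proof (rule pasting_lemma_locally_finite[where I = UNIV and T = ?T and f = ?f])
    fix x :: 'x
    obtain V where V: "open V" "x \<in> V" "finite {n. Y n \<inter> V \<noteq> {}}" by (rule locally_finite)
    have "{i \<in> UNIV. ?T i \<inter> V \<noteq> {}} \<subseteq> insert None (Some ` {n. Y n \<inter> V \<noteq> {}})"
      by (auto split: option.splits)
    then show "\<exists>V. openin euclidean V \<and> x \<in> V \<and> finite {i \<in> UNIV. ?T i \<inter> V \<noteq> {}}"
      using V by (intro exI[of _ V]) (auto intro: finite_subset)
    show "\<exists>j. j \<in> UNIV \<and> x \<in> ?T j \<and> glue h x = ?f j x"
    proof (cases "\<exists>n. x \<in> Y n")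
      case True
      then obtain n where "x \<in> Y n" by blast
      then show ?thesis by (intro exI[of _ "Some n"]) (simp add: glue_on)
    next
      case False
      then have "x \<in> ?Z" by (intro subsetD[OF closure_subset]) auto
      with False show ?thesis by (intro exI[of _ None]) (simp add: glue_off)
    qed
  next
    fix i show "closedin euclidean (?T i)"
      using compact by (auto split: option.split intro: compact_imp_closed)
    show "continuous_map (subtopology euclidean (?T i)) euclidean (?f i)"
      using assms(1) by (auto split: option.split simp: continuous_on_id')
  next
    fix i j x assume "x \<in> topspace euclidean \<inter> ?T i \<inter> ?T j"
    then show "?f i x = ?f j x"
      by (cases i; cases j) (auto simp: bd dest: same)
  qed
  then show ?thesis by simp
qed

lemma state_props:
  assumes "s \<in> states"
  shows "homeomorphism (Y n) (Y n) (fwd (s n)) (bwd (s n))"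
    and "y \<in> Y n \<Longrightarrow> y \<in> closure (- Y n) \<Longrightarrow> fwd (s n) y = y"
    and "rad (s n) > 0"
  using assms by (auto simp: states_def pieces_def)

lemma continuous_glue_fwd:
  assumes "s \<in> states" shows "continuous_on UNIV (glue (\<lambda>n. fwd (s n)))"
  using state_props[OF assms] by (intro continuous_glue) (auto simp: homeomorphism_def)

lemma glue_bwd_fwd:
  assumes "s \<in> states" shows "glue (\<lambda>n. bwd (s n)) (glue (\<lambda>n. fwd (s n)) x) = x"
proof (cases "\<exists>n. x \<in> Y n")
  case True
  then obtain n where "x \<in> Y n" by blast
  moreover from this have "fwd (s n) x \<in> Y n" "bwd (s n) (fwd (s n) x) = x"
    using state_props(1)[OF assms, of n] by (auto simp: homeomorphism_def)
  ultimately show ?thesis by (simp add: glue_on)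
qed (simp add: glue_off)

section \<open>The action on bounded functions and on the corona\<close>

lemma apply_act:
  assumes "s \<in> states" shows "apply_bcontfun (act s F) x = F (glue (\<lambda>n. fwd (s n)) x)"
proof -
  have "continuous_on UNIV (\<lambda>x. F (glue (\<lambda>n. fwd (s n)) x))"
    by (rule continuous_on_compose2[OF _ continuous_glue_fwd[OF assms], of UNIV])
      (auto intro: continuous_intros)
  then have "(\<lambda>x. F (glue (\<lambda>n. fwd (s n)) x)) \<in> bcontfun"
    by (rule bcontfun_normI) (rule norm_bounded)
  then show ?thesis by (simp add: act_def Bcontfun_inverse)
qed

lemma act_hom:
  assumes "s \<in> states"
  shows "act s (F + G) = act s F + act s G" "act s (F - G) = act s F - act s G"
    "act s (c *\<^sub>C F) = c *\<^sub>C act s F" "act s (F * G) = act s F * act s G" "act s (star F) = star (act s F)"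
  by (rule bcontfun_eqI; simp add: apply_act[OF assms])+

lemma act_flip: "s \<in> states \<Longrightarrow> act s (act (flip s) F) = F"
  by (rule bcontfun_eqI) (simp add: apply_act glue_bwd_fwd)

text \<open>The preimage of a compact set under the glued homeomorphism is its image under the
  continuous inverse, hence compact.\<close>

lemma vanishing_act:
  assumes s: "s \<in> states" and F: "F \<in> vanishing_at_infinity"
  shows "act s F \<in> vanishing_at_infinity"
proof (rule vanishingI)
  fix e :: real assume "e > 0"
  with F obtain K where K: "compact K" "\<And>x. x \<notin> K \<Longrightarrow> norm (F x) < e" using vanishingD by blast
  let ?L = "glue (\<lambda>n. bwd (s n)) ` K"
  have "compact ?L"
    using continuous_glue_fwd[of "flip s"] s K(1)
    by (intro compact_continuous_image) (auto intro: continuous_on_subset)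
  moreover have "norm (act s F x) < e" if "x \<notin> ?L" for x
  proof -
    have "glue (\<lambda>n. fwd (s n)) x \<notin> K" using that glue_bwd_fwd[OF s, of x] by (metis image_eqI)
    then show ?thesis using K(2) by (simp add: apply_act[OF s])
  qed
  ultimately show "\<exists>K. compact K \<and> (\<forall>x. x \<notin> K \<longrightarrow> norm (act s F x) < e)" by blast
qed

lemma abs_corona_act_cong:
  assumes "s \<in> states" "abs_corona F = abs_corona G"
  shows "abs_corona (act s F) = abs_corona (act s G)"
  using assms by (simp add: abs_corona_eq_iff vanishing_act flip: act_hom(2))

text \<open>For almost all \<open>n\<close> the two maps on \<open>Y n\<close> differ by at most
  \<open>rad (s n)\<close>, the scale at which \<open>F\<close> is controlled. The two actions agree
  off the pieces, so they differ by less than \<open>e\<close> outside finitely many pieces, whose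
  union is compact.\<close>

lemma abs_corona_act_le:
  assumes s: "s \<in> states" and t: "t \<in> states" and le: "le s t" and F: "controlled s F"
  shows "abs_corona (act s F) = abs_corona (act t F)"
proof (unfold abs_corona_eq_iff, rule vanishingI)
  fix e :: real assume "e > 0"
  then have "\<forall>\<^sub>\<infinity>n. inverse (real (Suc n)) < e"
    using order_tendstoD(2)[OF LIMSEQ_inverse_real_of_nat] by (simp add: cofinite_eq_sequentially)
  with le F have "\<forall>\<^sub>\<infinity>n. \<forall>x\<in>Y n. norm (F (fwd (s n) x) - F (fwd (t n) x)) < e"
    unfolding le_def controlled_def
  proof eventually_elim
    case (elim n)
    show ?case
    proof
      fix x assume x: "x \<in> Y n"
      then have "fwd (s n) x \<in> Y n" "fwd (t n) x \<in> Y n"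
        using state_props(1)[OF s, of n] state_props(1)[OF t, of n] by (auto simp: homeomorphism_def)
      moreover have "dist (fwd (s n) x) (fwd (t n) x) \<le> rad (s n)"
        using elim(1) x state_props(3)[OF t, of n] by (force simp: piece_le_def)
      ultimately show "norm (F (fwd (s n) x) - F (fwd (t n) x)) < e" using elim(2,3) by force
    qed
  qed
  then obtain N where N: "\<And>n x. n \<ge> N \<Longrightarrow> x \<in> Y n \<Longrightarrow> norm (F (fwd (s n) x) - F (fwd (t n) x)) < e"
    unfolding MOST_nat_le by blast
  have "norm (apply_bcontfun (act s F - act t F) x) < e" if "x \<notin> (\<Union>n<N. Y n)" for x
  proof (cases "\<exists>n. x \<in> Y n")
    case True
    then obtain n where n: "x \<in> Y n" by blast
    with that have "n \<ge> N" by force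
    with N n show ?thesis by (simp add: apply_act[OF s] apply_act[OF t] glue_on)
  qed (use \<open>e > 0\<close> in \<open>simp add: apply_act[OF s] apply_act[OF t] glue_off\<close>)
  moreover have "compact (\<Union>n<N. Y n)" using compact by blast
  ultimately show "\<exists>K. compact K \<and> (\<forall>x. x \<notin> K \<longrightarrow> norm (apply_bcontfun (act s F - act t F) x) < e)" by blast
qed

text \<open>Uniform continuity on each compact piece condenses \<open>F\<close> into a function
  \<open>g\<close> on the naturals. Thus a dominating family of such functions becomes a family of
  scales that controls every \<open>F\<close>.\<close>

lemma exists_modulus:
  fixes F :: "'x \<Rightarrow>\<^sub>C 'a::cstar_algebra"
  obtains g :: "nat \<Rightarrow> nat"
  where "\<And>s. \<forall>\<^sub>\<infinity>n. rad (s n) \<le> inverse (real (Suc (g n))) \<Longrightarrow> controlled s F"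
proof -
  have "\<exists>k. \<forall>x\<in>Y n. \<forall>y\<in>Y n. dist x y \<le> inverse (real (Suc k)) \<longrightarrow>
      norm (F x - F y) \<le> inverse (real (Suc n))" for n
  proof -
    have "uniformly_continuous_on (Y n) F"
      by (intro compact_uniformly_continuous compact) (auto intro: continuous_intros)
    then have "\<exists>d>0. \<forall>x\<in>Y n. \<forall>y\<in>Y n. dist y x < d \<longrightarrow> dist (F y) (F x) < inverse (real (Suc n))"
      unfolding uniformly_continuous_on_def by (rule allE[of _ "inverse (real (Suc n))"]) simp
    then obtain d where d: "d > 0"
      "\<And>x y. x \<in> Y n \<Longrightarrow> y \<in> Y n \<Longrightarrow> dist y x < d \<Longrightarrow> dist (F y) (F x) < inverse (real (Suc n))"
      by blast
    obtain k where k: "inverse (real (Suc k)) < d" using reals_Archimedean[OF d(1)] by blast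
    show ?thesis
    proof (intro exI ballI impI)
      fix x y assume "x \<in> Y n" "y \<in> Y n" "dist x y \<le> inverse (real (Suc k))"
      then show "norm (F x - F y) \<le> inverse (real (Suc n))"
        using d(2)[of y x] k by (simp add: dist_norm)
    qed
  qed
  then have "\<exists>g. \<forall>n. \<forall>x\<in>Y n. \<forall>y\<in>Y n. dist x y \<le> inverse (real (Suc (g n))) \<longrightarrow>
      norm (F x - F y) \<le> inverse (real (Suc n))" by (intro choice allI)
  then obtain g where g: "\<And>n x y. x \<in> Y n \<Longrightarrow> y \<in> Y n \<Longrightarrow> dist x y \<le> inverse (real (Suc (g n))) \<Longrightarrow>
      norm (F x - F y) \<le> inverse (real (Suc n))" by blast
  show thesis
  proof (rule that)
    fix s :: "nat \<Rightarrow> 'x piece" assume "\<forall>\<^sub>\<infinity>n. rad (s n) \<le> inverse (real (Suc (g n)))"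
    then show "controlled s F" unfolding controlled_def
    proof eventually_elim
      case (elim n)
      then show ?case using g[of _ n] order_trans by blast
    qed
  qed
qed

subsection \<open>Splitting\<close>

text \<open>Every point has an open neighbourhood that meets the range in a finite, hence closed,
  set.\<close>

lemma closed_range_choice:
  assumes "\<And>n. x n \<in> Y n" shows "closed (range x)"
proof -
  have "p \<in> range x" if p: "p \<in> closure (range x)" for p
  proof -
    obtain V where V: "open V" "p \<in> V" "finite {n. Y n \<inter> V \<noteq> {}}" by (rule locally_finite)
    have "V \<inter> range x \<subseteq> x ` {n. Y n \<inter> V \<noteq> {}}" using assms by blast
    then have "finite (V \<inter> range x)" using V(3) finite_surj by blast
    then have "closure (V \<inter> range x) = V \<inter> range x" by (simp add: finite_imp_closed)
    then show ?thesis using open_Int_closure_subset[OF V(1), of "range x"] p V(2) by blast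
  qed
  then show ?thesis by (metis closure_subset_eq subsetI)
qed

text \<open>A Urysohn function of the two ranges, multiplied by \<open>a\<close>. The ranges are
  closed and disjoint, so the denominator of \<open>h\<close> never vanishes.\<close>

lemma exists_separating_function:
  fixes a :: "'a::cstar_algebra"
  assumes x: "\<And>n. x n \<in> Y n" and y: "\<And>n. y n \<in> Y n" and ne: "\<And>n. x n \<noteq> y n"
  obtains F :: "'x \<Rightarrow>\<^sub>C 'a" where "\<And>n. F (x n) = 0" "\<And>n. F (y n) = a"
proof -
  let ?X = "range x" and ?Y = "range y"
  define h where "h z = infdist z ?X / (infdist z ?X + infdist z ?Y)" for z
  have zero: "infdist z ?X = 0 \<longleftrightarrow> z \<in> ?X" "infdist z ?Y = 0 \<longleftrightarrow> z \<in> ?Y" for z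
    using closed_range_choice[OF x] closed_range_choice[OF y] by (simp_all add: in_closed_iff_infdist_zero)
  have disj: "x n \<noteq> y m" for n m
    using x[of n] y[of m] ne[of n] disjoint_family_onD[OF disjoint, of n m] by (cases "n = m") auto
  have pos: "infdist z ?X + infdist z ?Y \<noteq> 0" for z
    using zero[of z] infdist_nonneg[of z ?X] infdist_nonneg[of z ?Y] disj by (smt (verit) image_iff)
  have h01: "\<bar>h z\<bar> \<le> 1" for z
    using infdist_nonneg[of z ?X] infdist_nonneg[of z ?Y] by (simp add: h_def divide_le_eq_1) linarith
  have "(\<lambda>z. h z *\<^sub>R a) \<in> bcontfun"
  proof (rule bcontfun_normI)
    show "continuous_on UNIV (\<lambda>z. h z *\<^sub>R a)"
      unfolding h_def using pos by (intro continuous_intros) auto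
    show "norm (h z *\<^sub>R a) \<le> norm a" for z
      using mult_right_mono[OF h01[of z] norm_ge_zero[of a]] by simp
  qed
  then have F: "apply_bcontfun (Bcontfun (\<lambda>z. h z *\<^sub>R a)) = (\<lambda>z. h z *\<^sub>R a)" by (rule Bcontfun_inverse)
  show thesis
  proof (rule that)
    fix n
    have "infdist (y n) ?X \<noteq> 0" using zero(1)[of "y n"] disj by (metis imageE)
    then show "Bcontfun (\<lambda>z. h z *\<^sub>R a) (y n) = a" unfolding F by (simp add: h_def infdist_zero)
    show "Bcontfun (\<lambda>z. h z *\<^sub>R a) (x n) = 0" unfolding F by (simp add: h_def infdist_zero)
  qed
qed

text \<open>The radius \<open>1\<close> is a placeholder; only membership of the two maps in \<open>pieces n\<close> matters.\<close>

lemma exists_small_perturbation: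
  assumes small: "\<And>e. e > 0 \<Longrightarrow>
      \<exists>\<tau>\<in>Homeo_bd (Y n). (\<forall>y\<in>Y n. dist y (\<tau> y) \<le> e) \<and> (\<exists>y\<in>Y n. \<tau> y \<noteq> y)"
    and p: "p \<in> pieces n" and e: "e > 0"
  shows "\<exists>\<tau> \<tau>' x. Piece (\<tau> \<circ> fwd p) (bwd p \<circ> \<tau>') 1 \<in> pieces n \<and>
    (\<forall>y\<in>Y n. dist (fwd p y) (\<tau> (fwd p y)) \<le> e \<and> dist (bwd p y) (bwd p (\<tau>' y)) \<le> e) \<and>
    x \<in> Y n \<and> \<tau> x \<in> Y n \<and> x \<noteq> \<tau> x"
proof -
  have hom: "homeomorphism (Y n) (Y n) (fwd p) (bwd p)" using p by (simp add: pieces_def)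
  \<comment> \<open>Composing \<open>fwd p\<close> with \<open>\<tau>\<close> turns the inverse into
    \<open>bwd p \<circ> \<tau>'\<close>; uniform continuity of \<open>bwd p\<close> tells how small
    \<open>\<tau>\<close> must be to keep this close to \<open>bwd p\<close>.\<close>
  then have "uniformly_continuous_on (Y n) (bwd p)"
    by (intro compact_uniformly_continuous compact) (simp add: homeomorphism_def)
  then have "\<exists>d>0. \<forall>x\<in>Y n. \<forall>y\<in>Y n. dist y x < d \<longrightarrow> dist (bwd p y) (bwd p x) < e"
    unfolding uniformly_continuous_on_def using e by blast
  then obtain d where d: "d > 0"
    "\<And>x y. x \<in> Y n \<Longrightarrow> y \<in> Y n \<Longrightarrow> dist y x < d \<Longrightarrow> dist (bwd p y) (bwd p x) < e" by blast
  have "min (d / 2) e > 0" using d e by simp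
  from small[OF this] obtain \<tau> where \<tau>: "\<tau> \<in> Homeo_bd (Y n)"
    "\<And>y. y \<in> Y n \<Longrightarrow> dist y (\<tau> y) \<le> d / 2" "\<And>y. y \<in> Y n \<Longrightarrow> dist y (\<tau> y) \<le> e" "\<exists>y\<in>Y n. \<tau> y \<noteq> y"
    by auto
  from \<tau>(1) obtain \<tau>' where hom': "homeomorphism (Y n) (Y n) \<tau> \<tau>'"
    and bd: "\<And>y. y \<in> Y n \<Longrightarrow> y \<in> closure (- Y n) \<Longrightarrow> \<tau> y = y" by (auto simp: Homeo_bd_def)
  have maps: "\<tau> y \<in> Y n" "\<tau>' y \<in> Y n" "\<tau>' (\<tau> y) = y" "\<tau> (\<tau>' y) = y" "fwd p y \<in> Y n" if "y \<in> Y n" for y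
    using hom hom' that by (auto simp: homeomorphism_def)
  have bd': "\<tau>' y = y" if "y \<in> Y n" "y \<in> closure (- Y n)" for y
    using bd[OF that] maps(3)[OF that(1)] by simp
  have "homeomorphism (Y n) (Y n) (\<tau> \<circ> fwd p) (bwd p \<circ> \<tau>')"
    by (rule homeomorphism_compose[OF hom hom'])
  then have "Piece (\<tau> \<circ> fwd p) (bwd p \<circ> \<tau>') 1 \<in> pieces n"
    using p bd bd' by (auto simp: pieces_def)
  moreover have "dist (bwd p y) (bwd p (\<tau>' y)) \<le> e" if "y \<in> Y n" for y
  proof -
    \<comment> \<open>The displacement of \<open>y\<close> by \<open>\<tau>'\<close> is that of
      \<open>\<tau>' y\<close> by \<open>\<tau>\<close>.\<close>
    have "dist y (\<tau>' y) < d"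
      using \<tau>(2)[of "\<tau>' y"] maps[OF that] d(1) by (simp add: dist_commute)
    then show ?thesis using d(2)[of "\<tau>' y" y] maps[OF that] that by simp
  qed
  moreover have "dist (fwd p y) (\<tau> (fwd p y)) \<le> e" if "y \<in> Y n" for y
    using \<tau>(3) maps(5)[OF that] by blast
  moreover obtain x where "x \<in> Y n" "\<tau> x \<noteq> x" using \<tau>(4) by blast
  ultimately show ?thesis using maps(1)[of x] by (intro exI[of _ \<tau>] exI[of _ \<tau>'] exI[of _ x]) auto
qed

text \<open>One refinement keeps the homeomorphisms of \<open>s\<close>, the other composes them
  with a small nontrivial \<open>\<tau> n\<close> on every piece. A function \<open>F\<close> that
  separates \<open>x n\<close> from \<open>\<tau> n (x n)\<close> for all \<open>n\<close> tells the
  two apart in the corona. \<open>F\<close> is chosen before the new radii, which can then be shrunk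
  until they control it.\<close>

lemma exists_splitting:
  fixes a :: "'a::cstar_algebra"
  assumes small: "\<And>n e. e > 0 \<Longrightarrow>
      \<exists>\<tau>\<in>Homeo_bd (Y n). (\<forall>y\<in>Y n. dist y (\<tau> y) \<le> e) \<and> (\<exists>y\<in>Y n. \<tau> y \<noteq> y)"
    and a: "a \<noteq> 0" and s: "s \<in> states"
  shows "\<exists>(t :: bool \<Rightarrow> nat \<Rightarrow> 'x piece) (F :: 'x \<Rightarrow>\<^sub>C 'a).
    (\<forall>b. t b \<in> states \<and> le s (t b) \<and> (\<forall>n. rad (t b n) \<le> inverse (real (Suc (g n)))) \<and> controlled (t b) F) \<and>
    abs_corona (act (t True) F) \<noteq> abs_corona (act (t False) F)"
proof -
  \<comment> \<open>Half of the radius is spent on the displacement and half is left for the new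
    radius, so the balls stay nested.\<close>
  define e where "e n = rad (s n) / 2" for n
  have e: "e n > 0" for n using state_props(3)[OF s] by (simp add: e_def)
  have sn: "s n \<in> pieces n" for n using s by (simp add: states_def)
  define R where "R n \<tau> \<tau>' x \<longleftrightarrow> Piece (\<tau> \<circ> fwd (s n)) (bwd (s n) \<circ> \<tau>') 1 \<in> pieces n \<and>
    (\<forall>y\<in>Y n. dist (fwd (s n) y) (\<tau> (fwd (s n) y)) \<le> e n \<and>
      dist (bwd (s n) y) (bwd (s n) (\<tau>' y)) \<le> e n) \<and>
    x \<in> Y n \<and> \<tau> x \<in> Y n \<and> x \<noteq> \<tau> x" for n \<tau> \<tau>' x
  have "\<exists>\<tau> \<tau>' x. R n \<tau> \<tau>' x" for n
    unfolding R_def by (rule exists_small_perturbation[OF small sn e])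
  then obtain \<tau> \<tau>' x where R: "\<And>n. R n (\<tau> n) (\<tau>' n) (x n)" by metis
  obtain F :: "'x \<Rightarrow>\<^sub>C 'a" where F: "\<And>n. F (x n) = 0" "\<And>n. F (\<tau> n (x n)) = a"
    using exists_separating_function[of x "\<lambda>n. \<tau> n (x n)" a] R unfolding R_def by blast
  obtain m where m: "\<And>s. \<forall>\<^sub>\<infinity>n. rad (s n) \<le> inverse (real (Suc (m n))) \<Longrightarrow> controlled s F"
    using exists_modulus by blast
  \<comment> \<open>The three terms secure nestedness, the prescribed scale and control of
    \<open>F\<close>.\<close>
  define r where "r n = min (e n) (min (inverse (real (Suc (g n)))) (inverse (real (Suc (m n)))))" for n
  have r: "r n > 0" "r n \<le> e n" "r n \<le> inverse (real (Suc (g n)))" "r n \<le> inverse (real (Suc (m n)))" for n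
    unfolding r_def using e[of n] by auto
  define t where "t b n = (if b then Piece (\<tau> n \<circ> fwd (s n)) (bwd (s n) \<circ> \<tau>' n) (r n)
    else Piece (fwd (s n)) (bwd (s n)) (r n))" for b n
  have rad_t: "rad (t b n) = r n" for b n by (simp add: t_def)
  have t: "t b \<in> states" for b
    unfolding states_def
  proof (clarify)
    fix n show "t b n \<in> pieces n"
      using R[of n] sn[of n] r(1)[of n] by (cases b) (simp_all add: t_def R_def pieces_def)
  qed
  have "piece_le (Y n) (s n) (t b n)" for b n
    unfolding piece_le_def
  proof (intro conjI ballI)
    show "rad (t b n) \<le> rad (s n)" using r(2)[of n] e[of n] by (simp add: rad_t e_def)
    fix y assume "y \<in> Y n"
    then have "dist (fwd (s n) y) (\<tau> n (fwd (s n) y)) \<le> e n" "dist (bwd (s n) y) (bwd (s n) (\<tau>' n y)) \<le> e n"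
      using R[of n] by (auto simp: R_def)
    moreover have "e n + r n \<le> rad (s n)" using r(2)[of n] by (simp add: e_def)
    ultimately show "dist (fwd (s n) y) (fwd (t b n) y) + rad (t b n) \<le> rad (s n)"
      "dist (bwd (s n) y) (bwd (t b n) y) + rad (t b n) \<le> rad (s n)"
      using e[of n] by (auto simp: t_def)
  qed
  then have "le s (t b)" for b by (simp add: le_def)
  moreover have "controlled (t b) F" for b by (rule m) (simp add: rad_t r(4) del: of_nat_Suc)
  moreover have "abs_corona (act (t True) F) \<noteq> abs_corona (act (t False) F)"
  proof
    assume "abs_corona (act (t True) F) = abs_corona (act (t False) F)"
    then obtain K where K: "compact K"
      "\<And>z. z \<notin> K \<Longrightarrow> norm (apply_bcontfun (act (t True) F - act (t False) F) z) < norm a"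
      using vanishingD[of "act (t True) F - act (t False) F" "norm a"] a by (auto simp: abs_corona_eq_iff)
    \<comment> \<open>At the preimage \<open>z\<close> of \<open>x n\<close> under
      \<open>fwd (s n)\<close> the actions take the values \<open>a\<close> and \<open>0\<close>, so
      \<open>K\<close> would have to meet every piece.\<close>
    have "K \<inter> Y n \<noteq> {}" for n
    proof -
      have x: "x n \<in> Y n" using R[of n] by (simp add: R_def)
      define z where "z = bwd (s n) (x n)"
      have z: "z \<in> Y n" "fwd (s n) z = x n"
        using state_props(1)[OF s, of n] x by (auto simp: homeomorphism_def z_def)
      then have "apply_bcontfun (act (t True) F - act (t False) F) z = a"
        by (simp add: apply_act[OF t] glue_on F) (simp add: t_def F)
      then have "z \<in> K" using K(2)[of z] by force
      with z show ?thesis by blast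
    qed
    then show False using finite_meet[OF K(1)] by simp
  qed
  ultimately show ?thesis using t r(3) rad_t by metis
qed

subsection \<open>Automorphisms from branches\<close>

text \<open>\<open>\<alpha>\<close> acts on a class through any level that controls a
  representative. Comparability of levels makes this independent of both choices, and finitely many
  functions are controlled at a common level, so the algebraic identities carry over from
  \<open>act\<close>.\<close>

lemma chain_induces_homomorphism:
  fixes S :: "'i \<Rightarrow> nat \<Rightarrow> 'x piece"
  assumes S: "\<And>i. i \<in> I \<Longrightarrow> S i \<in> states"
    and chain: "\<And>i j. i \<in> I \<Longrightarrow> j \<in> I \<Longrightarrow> le (S i) (S j) \<or> le (S j) (S i)"
    and cover: "\<And>F :: 'x \<Rightarrow>\<^sub>C 'a::cstar_algebra. \<exists>i\<in>I. controlled (S i) F"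
  obtains \<alpha> :: "('x, 'a::cstar_algebra) corona \<Rightarrow> ('x, 'a::cstar_algebra) corona"
  where "\<And>i F. i \<in> I \<Longrightarrow> controlled (S i) F \<Longrightarrow> \<alpha> (abs_corona F) = abs_corona (act (S i) F)"
    "\<And>p q. \<alpha> (p + q) = \<alpha> p + \<alpha> q" "\<And>c p. \<alpha> (c *\<^sub>C p) = c *\<^sub>C \<alpha> p"
    "\<And>p q. \<alpha> (p * q) = \<alpha> p * \<alpha> q" "\<And>p. \<alpha> (star p) = star (\<alpha> p)"
proof -
  have indep: "abs_corona (act (S i) F) = abs_corona (act (S j) G)"
    if "i \<in> I" "j \<in> I" "controlled (S i) F" "controlled (S j) G" "abs_corona F = abs_corona G"
    for i j and F G :: "'x \<Rightarrow>\<^sub>C 'a"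
    using chain[OF that(1,2)]
  proof
    assume "le (S i) (S j)"
    then show ?thesis
      using abs_corona_act_le[OF S S, of i j F] abs_corona_act_cong[OF S, of j F G] that by simp
  next
    assume "le (S j) (S i)"
    then show ?thesis
      using abs_corona_act_le[OF S S, of j i G] abs_corona_act_cong[OF S, of i F G] that by simp
  qed
  \<comment> \<open>Control persists under refinement, so the finer of two controlling levels
    controls both functions.\<close>
  have joint: "\<exists>i\<in>I. controlled (S i) F \<and> controlled (S i) G" for F G :: "'x \<Rightarrow>\<^sub>C 'a"
    using cover[of F] cover[of G] chain controlled_mono by metis
  have joint3: "\<exists>i\<in>I. controlled (S i) F \<and> controlled (S i) G \<and> controlled (S i) H" for F G H :: "'x \<Rightarrow>\<^sub>C 'a"
    using joint[of F G] cover[of H] chain controlled_mono by metis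
  define ix where "ix F = (SOME i. i \<in> I \<and> controlled (S i) F)" for F :: "'x \<Rightarrow>\<^sub>C 'a"
  have ix: "ix F \<in> I" "controlled (S (ix F)) F" for F
    using someI_ex[of "\<lambda>i. i \<in> I \<and> controlled (S i) F"] cover[of F] unfolding ix_def by blast+
  define \<alpha> :: "('x, 'a) corona \<Rightarrow> ('x, 'a) corona"
    where "\<alpha> p = abs_corona (act (S (ix (rep_corona p))) (rep_corona p))" for p
  have rep: "abs_corona (rep_corona p) = p" for p :: "('x, 'a) corona"
    by (rule Quotient_abs_rep[OF Quotient_corona])
  have \<alpha>: "\<alpha> (abs_corona F) = abs_corona (act (S i) F)" if "i \<in> I" "controlled (S i) F" for i F
    unfolding \<alpha>_def by (rule indep) (use that ix rep in auto)
  show thesis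
  proof (rule that)
    show "\<alpha> (abs_corona F) = abs_corona (act (S i) F)" if "i \<in> I" "controlled (S i) F" for i F
      by (rule \<alpha>[OF that])
  next
    fix p q :: "('x, 'a) corona" and c
    obtain F G where FG: "p = abs_corona F" "q = abs_corona G" by (metis rep)
    obtain i where i: "i \<in> I" "controlled (S i) F" "controlled (S i) G" "controlled (S i) (F + G)"
      using joint3 by blast
    show "\<alpha> (p + q) = \<alpha> p + \<alpha> q"
      using \<alpha>[OF i(1)] i by (simp add: FG plus_corona.abs_eq act_hom[OF S])
    obtain i where i: "i \<in> I" "controlled (S i) F" "controlled (S i) G" "controlled (S i) (F * G)"
      using joint3 by blast
    show "\<alpha> (p * q) = \<alpha> p * \<alpha> q"
      using \<alpha>[OF i(1)] i by (simp add: FG times_corona.abs_eq act_hom[OF S])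
    obtain i where i: "i \<in> I" "controlled (S i) F" "controlled (S i) (c *\<^sub>C F)" "controlled (S i) (star F)"
      using joint3 by blast
    show "\<alpha> (c *\<^sub>C p) = c *\<^sub>C \<alpha> p"
      using \<alpha>[OF i(1)] i by (simp add: FG scaleC_corona.abs_eq act_hom[OF S])
    show "\<alpha> (star p) = star (\<alpha> p)"
      using \<alpha>[OF i(1)] i by (simp add: FG star_corona.abs_eq act_hom[OF S])
  qed
qed

text \<open>The flipped chain satisfies the same hypotheses, and the homomorphism it induces is the
  inverse.\<close>

lemma chain_induces_automorphism:
  fixes S :: "'i \<Rightarrow> nat \<Rightarrow> 'x piece"
  assumes S: "\<And>i. i \<in> I \<Longrightarrow> S i \<in> states"
    and chain: "\<And>i j. i \<in> I \<Longrightarrow> j \<in> I \<Longrightarrow> le (S i) (S j) \<or> le (S j) (S i)"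
    and cover: "\<And>F :: 'x \<Rightarrow>\<^sub>C 'a::cstar_algebra. \<exists>i\<in>I. controlled (S i) F"
  obtains \<alpha> :: "('x, 'a::cstar_algebra) corona \<Rightarrow> ('x, 'a::cstar_algebra) corona"
  where "star_automorphism \<alpha>"
    "\<And>i F. i \<in> I \<Longrightarrow> controlled (S i) F \<Longrightarrow> \<alpha> (abs_corona F) = abs_corona (act (S i) F)"
proof -
  obtain \<alpha> :: "('x, 'a) corona \<Rightarrow> ('x, 'a) corona"
    where \<alpha>: "\<And>i F. i \<in> I \<Longrightarrow> controlled (S i) F \<Longrightarrow> \<alpha> (abs_corona F) = abs_corona (act (S i) F)"
    and hom: "\<And>p q. \<alpha> (p + q) = \<alpha> p + \<alpha> q" "\<And>c p. \<alpha> (c *\<^sub>C p) = c *\<^sub>C \<alpha> p"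
    "\<And>p q. \<alpha> (p * q) = \<alpha> p * \<alpha> q" "\<And>p. \<alpha> (star p) = star (\<alpha> p)"
    using chain_induces_homomorphism[OF S chain cover] by blast
  have flips: "\<And>i. i \<in> I \<Longrightarrow> flip (S i) \<in> states"
    "\<And>i j. i \<in> I \<Longrightarrow> j \<in> I \<Longrightarrow> le (flip (S i)) (flip (S j)) \<or> le (flip (S j)) (flip (S i))"
    "\<And>F :: 'x \<Rightarrow>\<^sub>C 'a. \<exists>i\<in>I. controlled (flip (S i)) F"
    using S chain cover by simp_all
  obtain \<beta> :: "('x, 'a) corona \<Rightarrow> ('x, 'a) corona"
    where \<beta>: "\<And>i F. i \<in> I \<Longrightarrow> controlled (S i) F \<Longrightarrow> \<beta> (abs_corona F) = abs_corona (act (flip (S i)) F)"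
    by (rule chain_induces_homomorphism[OF flips]) (assumption, assumption, assumption, rule that, simp)
  have rep: "\<exists>F. p = abs_corona F" for p :: "('x, 'a) corona"
    by (metis Quotient_abs_rep[OF Quotient_corona])
  \<comment> \<open>Stated for both directions at once: \<open>f = id\<close> gives
    \<open>\<alpha> (\<beta> p) = p\<close> and \<open>f = flip\<close> gives
    \<open>\<beta> (\<alpha> p) = p\<close>.\<close>
  have inverse: "u (v (abs_corona F)) = abs_corona F"
    if u: "\<And>i F. i \<in> I \<Longrightarrow> controlled (S i) F \<Longrightarrow> u (abs_corona F) = abs_corona (act (f (S i)) F)"
      and v: "\<And>i F. i \<in> I \<Longrightarrow> controlled (S i) F \<Longrightarrow> v (abs_corona F) = abs_corona (act (flip (f (S i))) F)"
      and f: "f = id \<or> f = flip"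
    for u v f and F :: "'x \<Rightarrow>\<^sub>C 'a"
  proof -
    have fS: "f (S i) \<in> states" if "i \<in> I" for i using S[OF that] f by auto
    obtain i where i: "i \<in> I" "controlled (S i) F" using cover by blast
    define G where "G = act (flip (f (S i))) F"
    obtain j where j: "j \<in> I" "controlled (S j) G" using cover by blast
    \<comment> \<open>\<open>G\<close> is formed at level \<open>i\<close>, which may not control
      it. At level \<open>k\<close> both maps can be evaluated, and there they cancel by
      \<open>act_flip\<close>.\<close>
    obtain k where k: "k \<in> I" "controlled (S k) F" "controlled (S k) G"
      using chain[OF i(1) j(1)] i j controlled_mono by blast
    have G: "abs_corona G = abs_corona (act (flip (f (S k))) F)"
      using v[OF i] v[OF k(1,2)] by (simp add: G_def)
    have "u (v (abs_corona F)) = u (abs_corona G)" using v[OF i] by (simp add: G_def)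
    also have "\<dots> = abs_corona (act (f (S k)) G)" by (rule u[OF k(1,3)])
    also have "\<dots> = abs_corona (act (f (S k)) (act (flip (f (S k))) F))"
      by (rule abs_corona_act_cong[OF fS[OF k(1)] G])
    finally show ?thesis by (simp add: act_flip fS k(1))
  qed
  have "\<alpha> (\<beta> p) = p" for p
    using rep[of p] inverse[of \<alpha> id \<beta>] \<alpha> \<beta> by auto
  moreover have "\<beta> (\<alpha> p) = p" for p
    using rep[of p] inverse[of \<beta> flip \<alpha>] \<alpha> \<beta> by auto
  ultimately have "bij \<alpha>" by (metis bijI')
  with hom have "star_automorphism \<alpha>" by (simp add: star_automorphism_def)
  with \<alpha> show thesis by (rule that[rotated])
qed

end

section \<open>Counting the automorphisms\<close>

lemma Card_order_aleph_1: "Card_order \<aleph>\<^sub>1"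
  by (rule cardSuc_Card_order[OF natLeq_Card_order])

lemma countable_underS_aleph_1: "countable (underS \<aleph>\<^sub>1 i)"
proof (cases "i \<in> Field \<aleph>\<^sub>1")
  case True
  then have "|underS \<aleph>\<^sub>1 i| <o \<aleph>\<^sub>1" by (rule card_of_underS[OF Card_order_aleph_1])
  then have "|underS \<aleph>\<^sub>1 i| \<le>o natLeq"
    using cardSuc_ordLeq_ordLess[OF natLeq_Card_order card_of_Card_order] by blast
  then have "|underS \<aleph>\<^sub>1 i| \<le>o |UNIV :: nat set|"
    by (rule ordLeq_ordIso_trans[OF _ ordIso_symmetric[OF card_of_nat]])
  then show ?thesis by (simp add: countable_def flip: card_of_ordLeq)
next
  case False
  then have "underS \<aleph>\<^sub>1 i = {}" by (auto simp: underS_def Field_def)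
  then show ?thesis by simp
qed

text \<open>A function is coded by its graph, a set of naturals via
  \<open>prod_encode\<close>.\<close>

lemma card_nat_functions_le_continuum: "|UNIV :: (nat \<Rightarrow> nat) set| \<le>o \<cc>"
proof -
  let ?code = "\<lambda>(f :: nat \<Rightarrow> nat) k. \<exists>n. k = prod_encode (n, f n)"
  have "inj ?code"
  proof (rule injI, rule ext)
    fix f g n assume "?code f = ?code g"
    then have "?code f (prod_encode (n, f n)) = ?code g (prod_encode (n, f n))" by metis
    then show "f n = g n" by auto
  qed
  moreover have "range ?code \<subseteq> Func UNIV UNIV" by (auto simp: Func_def)
  ultimately have "|UNIV :: (nat \<Rightarrow> nat) set| \<le>o |Func (UNIV :: nat set) (UNIV :: bool set)|"
    using card_of_ordLeq by blast
  then show ?thesis by (simp add: cexp_def ctwo_def Field_card_of Field_natLeq)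
qed

text \<open>The tree has the levels of \<open>\<aleph>\<^sub>1\<close>, and level \<open>i\<close>
  must reach the scale given by the \<open>i\<close>-th member of \<open>G\<close>. As
  \<open>G\<close> is cofinal, every function is controlled somewhere along every branch, so each
  branch induces an automorphism.\<close>

lemma (in flexible_pieces) many_automorphisms:
  fixes a :: "'a::cstar_algebra"
  assumes small: "\<And>n e. e > 0 \<Longrightarrow>
      \<exists>\<tau>\<in>Homeo_bd (Y n). (\<forall>y\<in>Y n. dist y (\<tau> y) \<le> e) \<and> (\<exists>y\<in>Y n. \<tau> y \<noteq> y)"
    and a: "a \<noteq> 0" and G: "cofinal_family G" "|G| \<le>o \<aleph>\<^sub>1"
  shows "ctwo ^c \<aleph>\<^sub>1 \<le>o |{\<Phi> :: ('x, 'a) corona \<Rightarrow> ('x, 'a) corona. star_automorphism \<Phi>}|"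
proof -
  let ?I = "Field \<aleph>\<^sub>1"
  have "G \<noteq> {}" using G(1) by (auto simp: cofinal_family_def)
  moreover have "|G| \<le>o |?I|"
    using G(2) card_of_Field_ordIso[OF Card_order_aleph_1] ordIso_symmetric ordLeq_ordIso_trans by blast
  \<comment> \<open>The enumeration \<open>d\<close> may repeat members of \<open>G\<close>.\<close>
  ultimately have "\<exists>d. d ` ?I = G" using card_of_ordLeq2[of G ?I] by simp
  then obtain d where d: "d ` ?I = G" ..
  define E where "E i s \<longleftrightarrow> (\<forall>n. rad (s n) \<le> inverse (real (Suc (d i n))))"
    for i and s :: "nat \<Rightarrow> 'x piece"
  define Q where "Q s t \<longleftrightarrow> (\<exists>F :: 'x \<Rightarrow>\<^sub>C 'a. controlled s F \<and> controlled t F \<and>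
    abs_corona (act s F) \<noteq> abs_corona (act t F))" for s t
  have closed: "\<exists>u\<in>states. \<forall>s\<in>C. le s u"
    if "countable C" "C \<subseteq> states" "\<And>s t. s \<in> C \<Longrightarrow> t \<in> C \<Longrightarrow> le s t \<or> le t s" for C
    using countable_chain_upper_bound_mod_finite[of "\<lambda>n. piece_le (Y n)" pieces C] that
      piece_le_refl piece_le_trans pieces_nonempty
    unfolding le_def states_def by (simp add: subset_iff) blast
  have split: "\<exists>t. (\<forall>b. t b \<in> states \<and> le s (t b) \<and> E i (t b)) \<and> Q (t True) (t False)"
    if "s \<in> states" for i s
    using exists_splitting[OF small a that, of "d i"] unfolding E_def Q_def by blast
  have sym: "Q t s" if "Q s t" for s t using that unfolding Q_def by metis
  have wo: "Well_order \<aleph>\<^sub>1" using Card_order_aleph_1 by (simp add: card_order_on_def)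
  obtain S :: "(nat set \<Rightarrow> bool) \<Rightarrow> nat set \<Rightarrow> nat \<Rightarrow> 'x piece"
    where S: "\<And>p i. S p i \<in> states" "\<And>p i. E i (S p i)"
    "\<And>p i j. (i, j) \<in> \<aleph>\<^sub>1 \<Longrightarrow> le (S p i) (S p j)"
    "\<And>p q i. i \<in> ?I \<Longrightarrow> p i \<noteq> q i \<Longrightarrow> \<exists>j\<in>?I. Q (S p j) (S q j)"
    by (rule binary_tree_of_chains[where E = E,
          OF wo countable_underS_aleph_1 le_refl le_trans closed split sym]) blast+
  have chain: "le (S p i) (S p j) \<or> le (S p j) (S p i)" if "i \<in> ?I" "j \<in> ?I" for p i j
  proof (cases "i = j")
    case False
    then have "(i, j) \<in> \<aleph>\<^sub>1 \<or> (j, i) \<in> \<aleph>\<^sub>1"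
      using wo that by (simp add: well_order_on_def linear_order_on_def total_on_def)
    then show ?thesis using S(3) by blast
  qed (simp add: le_refl)
  have cover: "\<exists>i\<in>?I. controlled (S p i) F" for p and F :: "'x \<Rightarrow>\<^sub>C 'a"
  proof -
    obtain g where g: "\<And>s. \<forall>\<^sub>\<infinity>n. rad (s n) \<le> inverse (real (Suc (g n))) \<Longrightarrow> controlled s F"
      by (rule exists_modulus[of F]) blast
    obtain i where i: "i \<in> ?I" "\<forall>\<^sub>\<infinity>n. g n \<le> d i n" using G(1) d unfolding cofinal_family_def by blast
    have "\<forall>\<^sub>\<infinity>n. rad (S p i n) \<le> inverse (real (Suc (g n)))"
      using i(2)
    proof eventually_elim
      case (elim n)
      have "rad (S p i n) \<le> inverse (real (Suc (d i n)))" using S(2) by (simp add: E_def)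
      also have "\<dots> \<le> inverse (real (Suc (g n)))" using elim by (intro le_imp_inverse_le) auto
      finally show ?case .
    qed
    then show ?thesis using g i(1) by blast
  qed
  have "\<exists>\<alpha> :: ('x, 'a) corona \<Rightarrow> ('x, 'a) corona. star_automorphism \<alpha> \<and>
      (\<forall>i\<in>?I. \<forall>F. controlled (S p i) F \<longrightarrow> \<alpha> (abs_corona F) = abs_corona (act (S p i) F))" for p
    by (rule chain_induces_automorphism[OF S(1) chain cover]) blast+
  then obtain \<alpha> :: "(nat set \<Rightarrow> bool) \<Rightarrow> ('x, 'a) corona \<Rightarrow> ('x, 'a) corona"
    where \<alpha>: "\<And>p. star_automorphism (\<alpha> p)"
      "\<And>p i F. i \<in> ?I \<Longrightarrow> controlled (S p i) F \<Longrightarrow> \<alpha> p (abs_corona F) = abs_corona (act (S p i) F)"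
    by metis
  \<comment> \<open>Members of \<open>Func ?I UNIV\<close> take a fixed value outside
    \<open>?I\<close>, so distinct ones differ at an actual level of the tree.\<close>
  have "inj_on \<alpha> (Func ?I UNIV)"
  proof (rule inj_onI, rule ccontr)
    fix p q :: "nat set \<Rightarrow> bool"
    assume pq: "p \<in> Func ?I UNIV" "q \<in> Func ?I UNIV" "\<alpha> p = \<alpha> q" "p \<noteq> q"
    then obtain i where "i \<in> ?I" "p i \<noteq> q i" unfolding Func_def by fastforce
    then have "\<exists>j\<in>?I. Q (S p j) (S q j)" by (rule S(4))
    then obtain j and F :: "'x \<Rightarrow>\<^sub>C 'a" where "j \<in> ?I" "controlled (S p j) F" "controlled (S q j) F"
      and ne: "abs_corona (act (S p j) F) \<noteq> abs_corona (act (S q j) F)"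
      unfolding Q_def by blast
    then have "\<alpha> p (abs_corona F) \<noteq> \<alpha> q (abs_corona F)" using \<alpha>(2) by simp
    with pq(3) show False by simp
  qed
  then have "|Func ?I (UNIV :: bool set)| \<le>o |{\<Phi> :: ('x, 'a) corona \<Rightarrow> ('x, 'a) corona. star_automorphism \<Phi>}|"
    by (rule card_of_ordLeqI) (simp add: \<alpha>(1))
  then show ?thesis by (simp add: cexp_def ctwo_def Field_card_of)
qed

section \<open>Small perturbations in flexible spaces and the conclusion\<close>

lemma radius_less_imp_dist_le:
  assumes "radius Y \<tau> < ennreal e" "y \<in> Y" shows "dist y (\<tau> y) \<le> e"
proof -
  have "ennreal (dist y (\<tau> y)) \<le> radius Y \<tau>"
    unfolding radius_def by (rule SUP_upper[OF assms(2), of "\<lambda>y. ennreal (dist y (\<tau> y))"])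
  then have "ennreal (dist y (\<tau> y)) < ennreal e" using assms(1) by (rule le_less_trans)
  then show ?thesis using ennreal_less_iff[of "dist y (\<tau> y)" e] by simp
qed

text \<open>For \<open>A = 0\<close> the corona is trivial, hence the nonzero \<open>a\<close>. As
  \<open>A\<close> may be arbitrarily large, the count is expressed as a lower bound.\<close>

theorem mainTheorem2:
  assumes "flexible_space TYPE('x::metric_space)"
    and "\<exists>a :: 'a::cstar_algebra. a \<noteq> 0"
  shows "(\<dd> =o \<aleph>\<^sub>1 \<and> ctwo ^c \<aleph>\<^sub>0 <o ctwo ^c \<aleph>\<^sub>1 \<longrightarrow>
            ctwo ^c \<aleph>\<^sub>1 \<le>o |{\<Phi> :: ('x, 'a) corona \<Rightarrow> ('x, 'a) corona. star_automorphism \<Phi>}| )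
       \<and> (CH \<longrightarrow>
            ctwo ^c \<cc> \<le>o |{\<Phi> :: ('x, 'a) corona \<Rightarrow> ('x, 'a) corona. star_automorphism \<Phi>}| )"
proof -
  obtain Y :: "nat \<Rightarrow> 'x set" and \<phi> :: "nat \<Rightarrow> nat \<Rightarrow> 'x \<Rightarrow> 'x"
    where lc: "locally_compact_space (euclidean :: 'x topology)" and Y: "disjoint_family Y"
      "\<forall>n. compact (Y n)" "\<forall>K. compact K \<longrightarrow> finite {n. K \<inter> Y n \<noteq> {}}"
      and \<phi>_Homeo: "\<forall>n m. \<phi> n m \<in> Homeo_bd (Y n)"
      and radii: "\<forall>n. decseq (\<lambda>m. radius (Y n) (\<phi> n m)) \<and>
        (\<lambda>m. radius (Y n) (\<phi> n m)) \<longlonglongrightarrow> 0 \<and> (\<forall>m. radius (Y n) (\<phi> n m) \<noteq> 0)"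
    using assms(1) unfolding flexible_space_def by (elim conjE exE) (rule that; assumption)
  then have \<phi>: "\<And>n m. \<phi> n m \<in> Homeo_bd (Y n)" "\<And>n. (\<lambda>m. radius (Y n) (\<phi> n m)) \<longlonglongrightarrow> 0"
    "\<And>n m. radius (Y n) (\<phi> n m) \<noteq> 0" by simp_all
  interpret flexible_pieces Y by unfold_locales (use lc Y in auto)
  have small: "\<exists>\<tau>\<in>Homeo_bd (Y n). (\<forall>y\<in>Y n. dist y (\<tau> y) \<le> e) \<and> (\<exists>y\<in>Y n. \<tau> y \<noteq> y)"
    if "e > 0" for n and e :: real
  proof -
    have "\<forall>\<^sub>F m in sequentially. radius (Y n) (\<phi> n m) < ennreal e"
      using order_tendstoD(2)[OF \<phi>(2)] that by simp
    then obtain m where m: "radius (Y n) (\<phi> n m) < ennreal e"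
      by (meson eventually_sequentially order_refl)
    \<comment> \<open>A map that fixes every point has radius zero.\<close>
    have "\<exists>y\<in>Y n. \<phi> n m y \<noteq> y"
    proof (rule ccontr)
      assume "\<not> ?thesis"
      then have "radius (Y n) (\<phi> n m) \<le> 0" unfolding radius_def by (intro SUP_least) simp
      then show False using \<phi>(3)[of n m] by simp
    qed
    then show ?thesis using \<phi>(1) radius_less_imp_dist_le[OF m] by blast
  qed
  obtain a :: 'a where a: "a \<noteq> 0" using assms(2) by blast
  show ?thesis
  proof (intro conjI impI)
    assume "\<dd> =o \<aleph>\<^sub>1 \<and> ctwo ^c \<aleph>\<^sub>0 <o ctwo ^c \<aleph>\<^sub>1"
    then obtain G where G: "cofinal_family G" "|G| \<le>o \<aleph>\<^sub>1"
      using least_cofinal_card_dominating_number ordIso_iff_ordLeq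
      unfolding least_cofinal_card_def by metis
    show "ctwo ^c \<aleph>\<^sub>1 \<le>o |{\<Phi> :: ('x, 'a) corona \<Rightarrow> ('x, 'a) corona. star_automorphism \<Phi>}|"
      by (rule many_automorphisms[OF small a G])
  next
    assume "CH"
    then have CH: "\<cc> =o \<aleph>\<^sub>1" by (simp add: CH_def)
    \<comment> \<open>Under \<open>CH\<close> the family of all functions is itself small enough to
      index the levels.\<close>
    have G: "cofinal_family UNIV" by (auto simp: cofinal_family_def intro: MOST_I)
    have UNIV_le: "|UNIV :: (nat \<Rightarrow> nat) set| \<le>o \<aleph>\<^sub>1"
      by (rule ordLeq_ordIso_trans[OF card_nat_functions_le_continuum CH])
    have "ctwo ^c \<aleph>\<^sub>1 \<le>o |{\<Phi> :: ('x, 'a) corona \<Rightarrow> ('x, 'a) corona. star_automorphism \<Phi>}|"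
      by (rule many_automorphisms[OF small a G UNIV_le])
    moreover have "ctwo ^c \<cc> =o ctwo ^c \<aleph>\<^sub>1"
      by (rule cexp_cong2[OF CH Card_order_ctwo Card_order_cexp])
    ultimately show "ctwo ^c \<cc> \<le>o |{\<Phi> :: ('x, 'a) corona \<Rightarrow> ('x, 'a) corona. star_automorphism \<Phi>}|"
      by (metis ordIso_ordLeq_trans)
  qed
qed

end
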